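(* Consider the following game, with $n\ge 2$. Let $\epsilon\in(0,\tfrac12)$ and let $\mathbf{a}_1,\dots,\mathbf{a}_m\in\mathbb{R}^n$ with $\sum_{i=1}^m \mathbf{a}_i\mathbf{a}_i^\top=\mathbf{M}$. Set $\alpha=C\epsilon^{-2}\log n$ and initialize $w_i=1$ for all $i$. While the game is not over, the following move is repeated: the adversary picks any $i\in\{1,\dots,m\}$ and $p\in(0,1]$ such that $w_i\neq 0$ and $\frac{w_i}{p}\mathbf{a}_i^\top\mathbf{M}^\dagger\mathbf{a}_i\le\frac1\alpha$ (if no such pair exists the game ends and the adversary loses); then, with probability $p$ (using fresh randomness independent of the history), $w_i\leftarrow w_i/p$, and otherwise $w_i\leftarrow 0$. The adversary may choose each move adaptively based on the entire history of the game. The adversary wins if at some point of the game the condition $(1-\epsilon)\mathbf{M}\preceq\sum_i w_i\mathbf{a}_i\mathbf{a}_i^\top\preceq(1+\epsilon)\mathbf{M}$ fails. Then for every constant $c>0$ there is a constant $C>0$ (in the definition of $\alpha$) such that, for every adversary strategy, the adversary wins with probability at most $n^{-c}$.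
   Context: $\mathbf{M}^\dagger$ denotes the Moore–Penrose pseudoinverse of $\mathbf{M}$. For symmetric matrices, $\mathbf{A}\preceq\mathbf{B}$ means $\mathbf{B}-\mathbf{A}$ is positive semidefinite. *)

theory Defs
  imports "HOL-Probability.Probability" "Jordan_Normal_Form.Matrix"
begin

no_notation inner (infix "\<bullet>" 70)
no_notation vec_nth (infixl "$" 90)

definition is_pinv :: "real mat \<Rightarrow> real mat \<Rightarrow> bool" where
  "is_pinv A X \<longleftrightarrow> X \<in> carrier_mat (dim_col A) (dim_row A) \<and>
     A * X * A = A \<and> X * A * X = X \<and>
     transpose_mat (A * X) = A * X \<and> transpose_mat (X * A) = X * A"

text \<open>The Moore-Penrose pseudoinverse, as the unique solution of the four Penrose equations.\<close>

definition pinv :: "real mat \<Rightarrow> real mat" where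
  "pinv A = (THE X. is_pinv A X)"

definition psd :: "real mat \<Rightarrow> bool" where
  "psd A \<longleftrightarrow> dim_row A = dim_col A \<and> transpose_mat A = A \<and>
     (\<forall>v \<in> carrier_vec (dim_row A). 0 \<le> v \<bullet> (A *\<^sub>v v))"

definition loewner_le :: "real mat \<Rightarrow> real mat \<Rightarrow> bool" where
  "loewner_le A B \<longleftrightarrow> psd (B - A)"

text \<open>The matrix \<open>\<Sum>i<m. w i * a i * (a i)^T\<close>, entry by entry. The vectors are indexed from 0.\<close>

definition gram :: "nat \<Rightarrow> nat \<Rightarrow> (nat \<Rightarrow> real vec) \<Rightarrow> (nat \<Rightarrow> real) \<Rightarrow> real mat" where
  "gram n m a w = mat n n (\<lambda>(j, k). \<Sum>i<m. w i * (a i $ j) * (a i $ k))"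

text \<open>A move is a pair \<open>(i, p)\<close>; its outcome is \<open>True\<close> if \<open>w i\<close> is scaled up.\<close>

type_synonym move = "nat \<times> real"

definition legal_move ::
  "nat \<Rightarrow> nat \<Rightarrow> (nat \<Rightarrow> real vec) \<Rightarrow> real \<Rightarrow> (nat \<Rightarrow> real) \<Rightarrow> move \<Rightarrow> bool" where
  "legal_move n m a \<alpha> w = (\<lambda>(i, p). i < m \<and> 0 < p \<and> p \<le> 1 \<and> w i \<noteq> 0 \<and>
     w i / p * (a i \<bullet> (pinv (gram n m a (\<lambda>_. 1)) *\<^sub>v a i)) \<le> 1 / \<alpha>)"

definition make_move :: "(nat \<Rightarrow> real) \<Rightarrow> move \<Rightarrow> bool \<Rightarrow> (nat \<Rightarrow> real)" where
  "make_move w = (\<lambda>(i, p) b. w(i := if b then w i / p else 0))"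

text \<open>
  A history is the list of outcomes so far, most recent first, and a (deterministic) strategy maps
  histories to moves. This is the entire history of the game: the outcomes together with the
  strategy itself determine all earlier moves and weights. For a legal strategy, a move that is
  not legal can only occur after the game has ended; the weights are then frozen, and all
  further outcomes are irrelevant.
\<close>

type_synonym strategy = "bool list \<Rightarrow> move"

primrec weights ::
  "nat \<Rightarrow> nat \<Rightarrow> (nat \<Rightarrow> real vec) \<Rightarrow> real \<Rightarrow> strategy \<Rightarrow> bool list \<Rightarrow> (nat \<Rightarrow> real)" where
  "weights n m a \<alpha> s [] = (\<lambda>_. 1)"
| "weights n m a \<alpha> s (b # h) =
     (let w = weights n m a \<alpha> s h
      in if legal_move n m a \<alpha> w (s h) then make_move w (s h) b else w)"

definition legal_strategy ::
  "nat \<Rightarrow> nat \<Rightarrow> (nat \<Rightarrow> real vec) \<Rightarrow> real \<Rightarrow> strategy \<Rightarrow> bool" where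
  "legal_strategy n m a \<alpha> s \<longleftrightarrow>
     (\<forall>h. (\<exists>mv. legal_move n m a \<alpha> (weights n m a \<alpha> s h) mv) \<longrightarrow>
          legal_move n m a \<alpha> (weights n m a \<alpha> s h) (s h))"

text \<open>
  The fresh randomness is an i.i.d. sequence of uniform variables on \<open>[0, 1]\<close>; round \<open>t\<close> with
  move \<open>(i, p)\<close> succeeds iff the \<open>t\<close>-th variable is at most \<open>p\<close>.
\<close>

definition coins :: "real stream measure" where
  "coins = stream_space (uniform_measure lborel {0..1})"

primrec history :: "strategy \<Rightarrow> real stream \<Rightarrow> nat \<Rightarrow> bool list" where
  "history s \<omega> 0 = []"
| "history s \<omega> (Suc t) = (\<omega> !! t \<le> snd (s (history s \<omega> t))) # history s \<omega> t"

definition adversary_wins ::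
  "nat \<Rightarrow> nat \<Rightarrow> (nat \<Rightarrow> real vec) \<Rightarrow> real \<Rightarrow> real \<Rightarrow> strategy \<Rightarrow> real stream \<Rightarrow> bool" where
  "adversary_wins n m a \<alpha> \<epsilon> s \<omega> \<longleftrightarrow>
     (\<exists>t. let M = gram n m a (\<lambda>_. 1); W = gram n m a (weights n m a \<alpha> s (history s \<omega> t))
          in \<not> (loewner_le ((1 - \<epsilon>) \<cdot>\<^sub>m M) W \<and> loewner_le W ((1 + \<epsilon>) \<cdot>\<^sub>m M)))"

text \<open>
  A randomized adversary draws a private seed from a Borel probability measure \<open>R\<close> on the reals,
  independently of the coins, and then plays \<open>\<sigma> r\<close>. A single real encodes private randomness
  from any standard Borel space; deterministic adversaries are those ignoring the seed.
\<close>

definition adversary ::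
  "nat \<Rightarrow> nat \<Rightarrow> (nat \<Rightarrow> real vec) \<Rightarrow> real \<Rightarrow> real measure \<Rightarrow> (real \<Rightarrow> strategy) \<Rightarrow> bool" where
  "adversary n m a \<alpha> R \<sigma> \<longleftrightarrow>
     prob_space R \<and> sets R = sets borel \<and>
     (\<forall>h. (\<lambda>r. \<sigma> r h) \<in> R \<rightarrow>\<^sub>M (count_space UNIV \<Otimes>\<^sub>M borel)) \<and>
     (\<forall>r. legal_strategy n m a \<alpha> (\<sigma> r))"

definition win_event ::
  "nat \<Rightarrow> nat \<Rightarrow> (nat \<Rightarrow> real vec) \<Rightarrow> real \<Rightarrow> real \<Rightarrow> real measure \<Rightarrow> (real \<Rightarrow> strategy) \<Rightarrow>
     (real \<times> real stream) set" where
  "win_event n m a \<alpha> \<epsilon> R \<sigma> =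
     {(r, \<omega>) \<in> space (R \<Otimes>\<^sub>M coins). adversary_wins n m a \<alpha> \<epsilon> (\<sigma> r) \<omega>}"

end

theory Submission
  imports Defs "Jordan_Normal_Form.Determinant"
begin

text \<open>
  Write \<open>L i j = a i \<bullet> (pinv M *\<^sub>v a j)\<close>; this is a symmetric projection of rank at most \<open>n\<close>, and it
  turns the statement into one about the matrices \<open>S w = L * diag w * L\<close> on the range of \<open>L\<close>. A legal
  move never lifts \<open>w i\<close> above \<open>K i = 1 / (\<alpha> * L i i)\<close>. Let \<open>X i \<in> {0, K i}\<close> be independent with mean
  \<open>w i\<close>. For every function \<open>f\<close>, the expectation of \<open>f X\<close> is affine in each \<open>w i\<close>, hence a martingale
  whatever the adversary plays. Taking \<open>f X = trace (exp (\<plusminus>\<theta> * S X))\<close>, Jensen's inequality bounds the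
  potential from below when the spectral condition fails, and Ville's inequality reduces the theorem to
  estimating the initial potential, a trace moment generating function of independent rank-one terms.

  That estimate avoids the inequalities of Lieb and of Golden and Thompson: differentiating in \<open>\<theta>\<close> and
  size-biasing each \<open>X l\<close> leaves a comparison of \<open>v \<bullet> exp (\<theta> * H) v\<close> under a rank-one update of \<open>H\<close> in
  the direction \<open>v\<close>, which follows from log-convexity of the moments \<open>v \<bullet> H ^ k v\<close>.
\<close>

subsection \<open>Moments of a weighted projection\<close>

lemma weighted_Cauchy_Schwarz:
  fixes c u v :: "'a \<Rightarrow> real"
  assumes "\<And>l. l \<in> A \<Longrightarrow> 0 \<le> c l"
  shows "(\<Sum>l\<in>A. c l * u l * v l)\<^sup>2 \<le> (\<Sum>l\<in>A. c l * u l * u l) * (\<Sum>l\<in>A. c l * v l * v l)"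
proof -
  have "(\<Sum>l\<in>A. (sqrt (c l) * u l) * (sqrt (c l) * v l))\<^sup>2
      \<le> (\<Sum>l\<in>A. (sqrt (c l) * u l)\<^sup>2) * (\<Sum>l\<in>A. (sqrt (c l) * v l)\<^sup>2)"
    by (rule Cauchy_Schwarz_ineq_sum)
  moreover have "(\<Sum>l\<in>A. (sqrt (c l) * u l) * (sqrt (c l) * v l)) = (\<Sum>l\<in>A. c l * u l * v l)"
    using assms by (intro sum.cong) (auto simp: mult.commute mult.left_commute)
  moreover have "(\<Sum>l\<in>A. (sqrt (c l) * w l)\<^sup>2) = (\<Sum>l\<in>A. c l * w l * w l)" for w :: "'a \<Rightarrow> real"
    using assms by (intro sum.cong) (auto simp: power_mult_distrib power2_eq_square)
  ultimately show ?thesis by simp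
qed

text \<open>Log-convexity means that the ratios \<open>s (Suc k) / s k\<close> do not decrease, so
  moving one unit of index from the smaller argument to the larger cannot lower the product. The
  division-free form \<open>shift\<close> also covers sequences with zeros.\<close>

lemma log_convex_mult_le:
  fixes s :: "nat \<Rightarrow> real"
  assumes nonneg: "\<And>k. 0 \<le> s k" and lc: "\<And>k. (s (Suc k))\<^sup>2 \<le> s k * s (Suc (Suc k))"
  shows "s a * s b \<le> s 0 * s (a + b)"
proof -
  have shift: "s (Suc k) * s j \<le> s k * s (Suc j)" if "k \<le> j" for k j
    using that
  proof (induction j rule: dec_induct)
    case base
    then show ?case by simp
  next
    case (step j)
    show ?case
    proof (cases "s j = 0")
      case True
      then have "s (Suc j) = 0" using lc[of j] by simp
      then show ?thesis using nonneg by simp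
    next
      case False
      have "s (Suc k) * s (Suc j) * s j = (s (Suc k) * s j) * s (Suc j)" by simp
      also have "\<dots> \<le> (s k * s (Suc j)) * s (Suc j)"
        by (rule mult_right_mono[OF step.IH nonneg])
      also have "\<dots> = s k * (s (Suc j))\<^sup>2" by (simp add: power2_eq_square)
      also have "\<dots> \<le> s k * (s j * s (Suc (Suc j)))"
        by (rule mult_left_mono[OF lc nonneg])
      finally have "(s (Suc k) * s (Suc j)) * s j \<le> (s k * s (Suc (Suc j))) * s j"
        by (simp add: mult_ac)
      then show ?thesis using False nonneg[of j] by simp
    qed
  qed
  have main: "s a * s b \<le> s 0 * s (a + b)" if "a \<le> b" for a b
    using that
  proof (induction a arbitrary: b)
    case (Suc a)
    then have "s (Suc a) * s b \<le> s a * s (Suc b)" by (intro shift) simp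
    also have "\<dots> \<le> s 0 * s (a + Suc b)" by (rule Suc.IH) (use Suc.prems in simp)
    finally show ?case by simp
  qed simp
  show ?thesis
    using main[of a b] main[of b a] by (cases "a \<le> b") (simp_all add: mult.commute add.commute)
qed

text \<open>The inner sum is the binomial convolution of the powers of \<open>\<tau>\<close> with
  \<open>s\<close>, so the exponential generating functions multiply.\<close>

lemma exp_sum_convolution_le:
  fixes s :: "nat \<Rightarrow> real"
  assumes "\<And>k. 0 \<le> s k" "0 \<le> \<tau>" "0 \<le> \<theta>"
  shows "(\<Sum>q<Q. \<theta> ^ q / fact q * (\<Sum>j\<le>q. real (q choose j) * \<tau> ^ j * s (q - j)))
      \<le> exp (\<theta> * \<tau>) * (\<Sum>q<Q. \<theta> ^ q / fact q * s q)"
proof -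
  define x where "x = (\<lambda>j. (\<theta> * \<tau>) ^ j / fact j)"
  define y where "y = (\<lambda>k. \<theta> ^ k / fact k * s k)"
  have x0: "0 \<le> x j" for j using assms by (simp add: x_def)
  have y0: "0 \<le> y j" for j using assms by (simp add: y_def)
  have "\<theta> ^ q / fact q * (\<Sum>j\<le>q. real (q choose j) * \<tau> ^ j * s (q - j)) = (\<Sum>j\<le>q. x j * y (q - j))" for q
    unfolding sum_distrib_left
  proof (intro sum.cong refl)
    fix j assume "j \<in> {..q}"
    then have j: "j \<le> q" by simp
    have "\<theta> ^ q = \<theta> ^ j * \<theta> ^ (q - j)" using j by (simp flip: power_add)
    then show "\<theta> ^ q / fact q * (real (q choose j) * \<tau> ^ j * s (q - j)) = x j * y (q - j)"
      by (simp add: x_def y_def binomial_fact[OF j] power_mult_distrib)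
  qed
  then have "(\<Sum>q<Q. \<theta> ^ q / fact q * (\<Sum>j\<le>q. real (q choose j) * \<tau> ^ j * s (q - j)))
      = (\<Sum>q<Q. \<Sum>j\<le>q. x j * y (q - j))" by simp
  also have "\<dots> = (\<Sum>(i, j)\<in>{(i, j). i + j < Q}. x i * y j)"
    by (rule sum.triangle_reindex[symmetric])
  \<comment> \<open>Truncation at total degree \<open>Q\<close> leaves a triangle of index pairs;
    the enclosing square adds only nonnegative terms, and its sum factorises.\<close>
  also have "\<dots> \<le> (\<Sum>(i, j)\<in>{..<Q} \<times> {..<Q}. x i * y j)"
    using x0 y0 by (intro sum_mono2) auto
  also have "\<dots> = (\<Sum>i<Q. x i) * (\<Sum>j<Q. y j)"
    by (simp add: sum_product sum.cartesian_product)
  also have "(\<Sum>i<Q. x i) \<le> exp (\<theta> * \<tau>)"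
    unfolding x_def using assms(2,3) summable_exp[of "\<theta> * \<tau>"]
    by (subst exp_def) (auto intro!: sum_le_suminf simp: scaleR_conv_of_real divide_inverse mult.commute)
  finally show ?thesis
    using y0 by (simp add: y_def sum_nonneg mult_right_mono)
qed

section \<open>Powers of a diagonal operator compressed to the range of a projection\<close>

locale projection_kernel =
  fixes m :: nat and L :: "nat \<Rightarrow> nat \<Rightarrow> real"
  assumes L_sym: "\<And>i j. i < m \<Longrightarrow> j < m \<Longrightarrow> L i j = L j i"
    and L_idem: "\<And>i k. i < m \<Longrightarrow> k < m \<Longrightarrow> (\<Sum>j<m. L i j * L j k) = L i k"
begin

definition fixed :: "(nat \<Rightarrow> real) set" where
  "fixed = {v. \<forall>j<m. (\<Sum>l<m. L j l * v l) = v j}"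

text \<open>On \<open>fixed\<close>, the range of the projection \<open>L\<close>, this is the operator \<open>L * diag c * L\<close>.\<close>

definition wop :: "(nat \<Rightarrow> real) \<Rightarrow> (nat \<Rightarrow> real) \<Rightarrow> nat \<Rightarrow> real" where
  "wop c v = (\<lambda>j. \<Sum>l<m. L j l * c l * v l)"

definition moment :: "(nat \<Rightarrow> real) \<Rightarrow> (nat \<Rightarrow> real) \<Rightarrow> nat \<Rightarrow> real" where
  "moment c v k = (\<Sum>j<m. v j * (wop c ^^ k) v j)"

lemma sum_L_fixed: "v \<in> fixed \<Longrightarrow> j < m \<Longrightarrow> (\<Sum>l<m. L j l * v l) = v j"
  by (simp add: fixed_def)

lemma row_fixed:
  assumes "i < m"
  shows "L i \<in> fixed"
  unfolding fixed_def
proof clarify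
  fix j assume j: "j < m"
  have "(\<Sum>l<m. L j l * L i l) = (\<Sum>l<m. L j l * L l i)"
    using assms by (intro sum.cong refl) (simp add: L_sym[of i])
  then show "(\<Sum>l<m. L j l * L i l) = L i j"
    using assms j by (simp add: L_idem L_sym[of i])
qed

lemma diag_eq_sum_squares:
  assumes i: "i < m"
  shows "L i i = (\<Sum>j<m. (L i j)\<^sup>2)"
proof -
  have "L i i = (\<Sum>j<m. L i j * L j i)"
    by (rule L_idem[OF i i, symmetric])
  also have "\<dots> = (\<Sum>j<m. (L i j)\<^sup>2)"
  proof (intro sum.cong refl)
    fix j assume "j \<in> {..<m}"
    then have "L j i = L i j" by (intro L_sym i) simp
    then show "L i j * L j i = (L i j)\<^sup>2" by (simp add: power2_eq_square)
  qed
  finally show ?thesis .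
qed

lemma wop_fixed: "wop c v \<in> fixed"
  unfolding fixed_def
proof (clarify)
  fix j assume j: "j < m"
  have "(\<Sum>l<m. L j l * wop c v l) = (\<Sum>l<m. \<Sum>k<m. L j l * (L l k * c k * v k))"
    by (simp add: wop_def sum_distrib_left)
  also have "\<dots> = (\<Sum>k<m. (\<Sum>l<m. L j l * L l k) * (c k * v k))"
    by (subst sum.swap) (simp add: sum_distrib_right mult.assoc)
  also have "\<dots> = wop c v j"
    using j by (simp add: L_idem wop_def mult.assoc)
  finally show "(\<Sum>l<m. L j l * wop c v l) = wop c v j" .
qed

lemma wop_pow_fixed: "v \<in> fixed \<Longrightarrow> (wop c ^^ k) v \<in> fixed"
  by (induction k) (simp_all add: wop_fixed)

text \<open>The projection inside \<open>wop\<close> is symmetric and fixes \<open>u\<close>, so it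
  is absorbed and only the diagonal form with weights \<open>c\<close> remains.\<close>

lemma dot_wop:
  assumes "u \<in> fixed"
  shows "(\<Sum>j<m. u j * wop c v j) = (\<Sum>l<m. c l * u l * v l)"
proof -
  have "(\<Sum>j<m. u j * wop c v j) = (\<Sum>j<m. \<Sum>l<m. u j * (L j l * c l * v l))"
    by (simp add: wop_def sum_distrib_left)
  also have "\<dots> = (\<Sum>l<m. (\<Sum>j<m. L l j * u j) * (c l * v l))"
    unfolding sum_distrib_right
    by (subst sum.swap) (auto intro!: sum.cong simp: L_sym mult_ac)
  also have "\<dots> = (\<Sum>l<m. c l * u l * v l)"
    by (intro sum.cong refl) (subst sum_L_fixed[OF assms], simp_all)
  finally show ?thesis .
qed

lemma wop_symmetric:
  assumes "u \<in> fixed" "v \<in> fixed"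
  shows "(\<Sum>j<m. u j * (wop c ^^ k) v j) = (\<Sum>j<m. (wop c ^^ k) u j * v j)"
  using assms(2)
proof (induction k arbitrary: v)
  case (Suc k)
  have "(\<Sum>j<m. u j * (wop c ^^ Suc k) v j) = (\<Sum>j<m. u j * (wop c ^^ k) (wop c v) j)"
    by (simp add: funpow_swap1)
  also have "\<dots> = (\<Sum>j<m. (wop c ^^ k) u j * wop c v j)"
    by (rule Suc.IH[OF wop_fixed])
  also have "\<dots> = (\<Sum>j<m. v j * wop c ((wop c ^^ k) u) j)"
    using dot_wop[OF wop_pow_fixed[OF assms(1), where c=c and k=k], where c=c and v=v]
      dot_wop[OF Suc.prems, where c=c and v="(wop c ^^ k) u"] by (simp add: mult_ac)
  finally show ?case by (simp add: mult.commute)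
qed simp

lemma moment_add:
  assumes "v \<in> fixed"
  shows "(\<Sum>j<m. (wop c ^^ a) v j * (wop c ^^ b) v j) = moment c v (a + b)"
  unfolding moment_def funpow_add
  by (simp add: wop_symmetric[OF assms wop_pow_fixed[OF assms]])

text \<open>By symmetry one operator can be kept in the middle, where \<open>dot_wop\<close> turns
  it into the weights \<open>c\<close>. Odd moments are thus weighted inner products, as even
  moments are plain ones.\<close>

lemma moment_add_Suc:
  assumes "v \<in> fixed"
  shows "(\<Sum>l<m. c l * (wop c ^^ a) v l * (wop c ^^ b) v l) = moment c v (Suc (a + b))"
  using dot_wop[OF wop_pow_fixed[OF assms, where c=c and k=a], where c=c and v="(wop c ^^ b) v"]
    moment_add[OF assms, where c=c and a=a and b="Suc b"] by simp

lemma moment_nonneg: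
  assumes "v \<in> fixed" "\<And>l. l < m \<Longrightarrow> 0 \<le> c l"
  shows "0 \<le> moment c v k"
proof (cases "even k")
  case True
  then obtain a where "k = a + a" by (auto elim!: evenE simp: mult_2)
  then show ?thesis
    using moment_add[OF assms(1), where c=c and a=a and b=a] by (metis sum_nonneg zero_le_square)
next
  case False
  then obtain a where k: "k = Suc (a + a)" by (auto elim!: oddE simp: mult_2)
  have "0 \<le> (\<Sum>l<m. c l * (wop c ^^ a) v l * (wop c ^^ a) v l)"
    using assms(2) by (intro sum_nonneg) (simp add: mult.assoc)
  then show ?thesis
    by (simp add: moment_add_Suc[OF assms(1)] k)
qed

text \<open>Cauchy-Schwarz for the iterates of order \<open>a\<close> and \<open>Suc a\<close>, in
  the plain inner product for even \<open>k\<close> and in the \<open>c\<close>-weighted one for odd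
  \<open>k\<close>.\<close>

lemma moment_log_convex:
  assumes "v \<in> fixed" "\<And>l. l < m \<Longrightarrow> 0 \<le> c l"
  shows "(moment c v (Suc k))\<^sup>2 \<le> moment c v k * moment c v (Suc (Suc k))"
proof (cases "even k")
  case True
  then obtain a where k: "k = a + a" by (auto elim!: evenE simp: mult_2)
  have "(\<Sum>j<m. 1 * (wop c ^^ a) v j * (wop c ^^ Suc a) v j)\<^sup>2
      \<le> (\<Sum>j<m. 1 * (wop c ^^ a) v j * (wop c ^^ a) v j)
        * (\<Sum>j<m. 1 * (wop c ^^ Suc a) v j * (wop c ^^ Suc a) v j)"
    by (rule weighted_Cauchy_Schwarz) simp
  then show ?thesis
    unfolding mult_1 moment_add[OF assms(1)] k by simp
next
  case False
  then obtain a where k: "k = Suc (a + a)" by (auto elim!: oddE simp: mult_2)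
  have "(\<Sum>j<m. c j * (wop c ^^ a) v j * (wop c ^^ Suc a) v j)\<^sup>2
      \<le> (\<Sum>j<m. c j * (wop c ^^ a) v j * (wop c ^^ a) v j)
        * (\<Sum>j<m. c j * (wop c ^^ Suc a) v j * (wop c ^^ Suc a) v j)"
    by (rule weighted_Cauchy_Schwarz) (simp add: assms(2))
  then show ?thesis
    unfolding moment_add_Suc[OF assms(1)] k by simp
qed

lemma moment_mult_le:
  assumes "v \<in> fixed" "\<And>l. l < m \<Longrightarrow> 0 \<le> c l"
  shows "moment c v a * moment c v b \<le> moment c v 0 * moment c v (a + b)"
  by (rule log_convex_mult_le) (use moment_nonneg[of v c, OF assms] moment_log_convex[of v c, OF assms] in auto)

text \<open>Jensen's inequality for powers under the spectral measure of \<open>v\<close>, reached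
  by induction from log-convexity instead of a spectral decomposition.\<close>

lemma moment_ge_power:
  assumes "v \<in> fixed" "\<And>l. l < m \<Longrightarrow> 0 \<le> c l" "0 < moment c v 0"
  shows "(moment c v 1 / moment c v 0) ^ q \<le> moment c v q / moment c v 0"
proof (induction q)
  case (Suc q)
  let ?s = "moment c v"
  have "(?s 1 / ?s 0) ^ Suc q \<le> (?s 1 / ?s 0) * (?s q / ?s 0)"
    unfolding power_Suc
    by (rule mult_left_mono[OF Suc.IH]) (use moment_nonneg[of v c 1, OF assms(1,2)] assms(3) in simp)
  also have "\<dots> \<le> (?s 0 * ?s (Suc q)) / (?s 0 * ?s 0)"
    using divide_right_mono[OF moment_mult_le[of v c 1 q, OF assms(1,2)], of "?s 0 * ?s 0"] assms(3)
    by simp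
  also have "\<dots> = ?s (Suc q) / ?s 0" using assms(3) by simp
  finally show ?case .
qed (use assms(3) in simp)

text \<open>With \<open>H = L * diag c * L\<close> this is the \<open>i\<close>-th diagonal entry of
  \<open>H ^ k\<close>. The power zero is \<open>L\<close>, not the identity, so
  \<open>trace_moment\<close> is the trace on the range of \<open>L\<close>.\<close>

definition diag_moment :: "(nat \<Rightarrow> real) \<Rightarrow> nat \<Rightarrow> nat \<Rightarrow> real" where
  "diag_moment c i k = (wop c ^^ k) (L i) i"

definition trace_moment :: "(nat \<Rightarrow> real) \<Rightarrow> nat \<Rightarrow> real" where
  "trace_moment c k = (\<Sum>i<m. diag_moment c i k)"

lemma moment_row:
  assumes "i < m"
  shows "moment c (L i) k = diag_moment c i k"
  unfolding moment_def diag_moment_def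
  by (rule sum_L_fixed[OF wop_pow_fixed[OF row_fixed[OF assms]] assms])

lemma diag_moment_0: "diag_moment c i 0 = L i i"
  by (simp add: diag_moment_def)

lemma diag_moment_nonneg: "i < m \<Longrightarrow> (\<And>l. l < m \<Longrightarrow> 0 \<le> c l) \<Longrightarrow> 0 \<le> diag_moment c i k"
  using moment_nonneg[OF row_fixed[of i], where c=c and k=k] by (simp add: moment_row)

lemma wop_pow_eq_dot_row:
  assumes "v \<in> fixed" "j < m"
  shows "(wop c ^^ k) v j = (\<Sum>l<m. (wop c ^^ k) (L j) l * v l)"
  using wop_symmetric[OF row_fixed[OF assms(2)] assms(1), where c=c and k=k]
    sum_L_fixed[OF wop_pow_fixed[OF assms(1), where c=c and k=k] assms(2)] by simp

text \<open>Cyclicity of the trace: one factor \<open>H\<close> is opened up and releases its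
  weights. In this form the derivative of the exponential series in \<open>\<theta>\<close>
  separates into the single weights.\<close>

lemma trace_moment_Suc: "trace_moment c (Suc q) = (\<Sum>l<m. c l * diag_moment c l q)"
proof -
  have swap: "(wop c ^^ q) (L i) l = (wop c ^^ q) (L l) i" if "i < m" "l < m" for i l
  proof -
    have "(wop c ^^ q) (L i) l = (\<Sum>k<m. (wop c ^^ q) (L l) k * L i k)"
      by (rule wop_pow_eq_dot_row[OF row_fixed]) fact+
    also have "\<dots> = (\<Sum>k<m. L i k * (wop c ^^ q) (L l) k)" by (simp add: mult.commute)
    also have "\<dots> = (wop c ^^ q) (L l) i"
      by (rule sum_L_fixed[OF wop_pow_fixed[OF row_fixed]]) fact+
    finally show ?thesis .
  qed
  have "trace_moment c (Suc q) = (\<Sum>i<m. \<Sum>l<m. L i l * c l * (wop c ^^ q) (L i) l)"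
    by (simp add: trace_moment_def diag_moment_def wop_def)
  also have "\<dots> = (\<Sum>l<m. \<Sum>i<m. c l * (L l i * (wop c ^^ q) (L l) i))"
    by (subst sum.swap) (auto intro!: sum.cong simp: swap L_sym mult_ac)
  also have "\<dots> = (\<Sum>l<m. c l * diag_moment c l q)"
    by (simp add: sum_distrib_left[symmetric] sum_L_fixed[OF wop_pow_fixed[OF row_fixed]] diag_moment_def)
  finally show ?thesis .
qed

text \<open>Each coordinate of \<open>H ^ a v\<close> pairs \<open>v\<close> with a row of
  \<open>H ^ a\<close>, so Cauchy-Schwarz bounds its square by a diagonal entry of
  \<open>H ^ (a + a)\<close>. Summation with weights one (even \<open>k\<close>) or \<open>c\<close>
  (odd \<open>k\<close>) produces the trace.\<close>

lemma moment_le_trace: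
  assumes "v \<in> fixed" "\<And>l. l < m \<Longrightarrow> 0 \<le> c l"
  shows "moment c v k \<le> trace_moment c k * moment c v 0"
proof -
  have m0: "moment c v 0 = (\<Sum>l<m. 1 * v l * v l)" by (simp add: moment_def)
  have sq: "(wop c ^^ a) v j * (wop c ^^ a) v j \<le> diag_moment c j (a + a) * moment c v 0" if "j < m" for a j
  proof -
    have "((wop c ^^ a) v j)\<^sup>2 = (\<Sum>l<m. 1 * (wop c ^^ a) (L j) l * v l)\<^sup>2"
      using wop_pow_eq_dot_row[OF assms(1) that] by simp
    also have "\<dots> \<le> (\<Sum>l<m. 1 * (wop c ^^ a) (L j) l * (wop c ^^ a) (L j) l) * (\<Sum>l<m. 1 * v l * v l)"
      by (rule weighted_Cauchy_Schwarz) simp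
    also have "\<dots> = diag_moment c j (a + a) * moment c v 0"
      unfolding m0 using moment_add[OF row_fixed[OF that], where c=c and a=a and b=a] by (simp add: moment_row[OF that])
    finally show ?thesis by (simp add: power2_eq_square)
  qed
  show ?thesis
  proof (cases "even k")
    case True
    then obtain a where k: "k = a + a" by (auto elim!: evenE simp: mult_2)
    have "moment c v k = (\<Sum>j<m. (wop c ^^ a) v j * (wop c ^^ a) v j)"
      by (simp add: k moment_add[OF assms(1)])
    also have "\<dots> \<le> (\<Sum>j<m. diag_moment c j (a + a) * moment c v 0)"
      by (intro sum_mono sq) simp
    finally show ?thesis by (simp add: k trace_moment_def sum_distrib_right)
  next
    case False
    then obtain a where k: "k = Suc (a + a)" by (auto elim!: oddE simp: mult_2)
    have "moment c v k = (\<Sum>j<m. c j * ((wop c ^^ a) v j * (wop c ^^ a) v j))"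
      by (simp add: k moment_add_Suc[OF assms(1), symmetric] mult.assoc)
    also have "\<dots> \<le> (\<Sum>j<m. c j * (diag_moment c j (a + a) * moment c v 0))"
      by (intro sum_mono mult_left_mono sq assms(2)) simp_all
    also have "\<dots> = trace_moment c k * moment c v 0"
      unfolding k trace_moment_Suc by (simp add: sum_distrib_right mult.assoc)
    finally show ?thesis .
  qed
qed

text \<open>The Rayleigh quotient of \<open>v\<close> stands in for the largest eigenvalue: its
  powers lie below the normalised moments, and these below the trace.\<close>

lemma trace_moment_ge_power:
  assumes "v \<in> fixed" "\<And>l. l < m \<Longrightarrow> 0 \<le> c l" "0 < (\<Sum>l<m. v l * v l)"
  shows "((\<Sum>l<m. c l * v l * v l) / (\<Sum>l<m. v l * v l)) ^ q \<le> trace_moment c q"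
proof -
  have m0: "moment c v 0 = (\<Sum>l<m. v l * v l)" by (simp add: moment_def)
  have m1: "moment c v 1 = (\<Sum>l<m. c l * v l * v l)"
    using moment_add_Suc[OF assms(1), where c=c and a=0 and b=0] by simp
  have "(moment c v 1 / moment c v 0) ^ q \<le> moment c v q / moment c v 0"
    by (rule moment_ge_power[OF assms(1,2)]) (simp_all add: m0 assms(3))
  also have "\<dots> \<le> trace_moment c q"
    using moment_le_trace[of v c q, OF assms(1,2)] assms(3) by (simp add: m0 divide_le_eq)
  finally show ?thesis by (simp only: m0 m1)
qed

text \<open>
  A rank-one version of the Golden--Thompson inequality: adding \<open>t\<close> to the weight \<open>c i\<close> adds
  \<open>t\<close> times the rank-one matrix of \<open>L i\<close> to the operator.
\<close>

lemma rank_one_update_le: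
  assumes i: "i < m" and c: "\<And>l. l < m \<Longrightarrow> 0 \<le> c l" and t: "0 \<le> t"
  defines "c' \<equiv> c(i := c i + t)"
  shows "(\<Sum>j<m. (wop c ^^ b) (L i) j * (wop c' ^^ a) (L i) j)
    \<le> (\<Sum>j\<le>a. real (a choose j) * (t * L i i) ^ j * diag_moment c i (a - j + b))"
proof (induction a arbitrary: b)
  case 0
  show ?case
    using moment_add[OF row_fixed[OF i], where c=c and a=b and b=0] by (simp add: moment_row[OF i])
next
  case (Suc a)
  define \<tau> where "\<tau> = t * L i i"
  let ?s = "diag_moment c i"
  let ?y = "\<lambda>b. (wop c ^^ b) (L i)" and ?z = "\<lambda>a. (wop c' ^^ a) (L i)"
  have fy: "?y b \<in> fixed" and fz: "?z a \<in> fixed" for a b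
    by (rule wop_pow_fixed[OF row_fixed[OF i]])+
  have s0: "0 \<le> ?s k" for k by (rule diag_moment_nonneg[OF i c])
  \<comment> \<open>One factor of the updated operator is peeled off. Its old part passes to the
    left vector and raises \<open>b\<close>, hence the generalised induction; its new part has rank
    one and splits into a product.\<close>
  have "(\<Sum>j<m. ?y b j * ?z (Suc a) j) = (\<Sum>l<m. c' l * ?y b l * ?z a l)"
    by (simp add: dot_wop[OF fy])
  also have "\<dots> = (\<Sum>l<m. c l * ?y b l * ?z a l + (if l = i then t * ?y b i * ?z a i else 0))"
    by (intro sum.cong) (auto simp: c'_def algebra_simps)
  also have "\<dots> = (\<Sum>l<m. c l * ?z a l * ?y b l) + t * ?y b i * ?z a i"
    using i by (simp add: sum.distrib mult_ac)
  finally have step: "(\<Sum>j<m. ?y b j * ?z (Suc a) j)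
      = (\<Sum>l<m. c l * ?z a l * ?y b l) + t * ?s b * ?z a i"
    by (simp add: diag_moment_def)
  have "(\<Sum>l<m. c l * ?z a l * ?y b l) = (\<Sum>j<m. ?y (Suc b) j * ?z a j)"
    using dot_wop[OF fz, where c=c and v="?y b"] by (simp add: mult.commute)
  then have first: "(\<Sum>l<m. c l * ?z a l * ?y b l)
      \<le> (\<Sum>j\<le>a. real (a choose j) * \<tau> ^ j * ?s (a - j + Suc b))"
    using Suc.IH[of "Suc b"] by (simp only: \<tau>_def)
  have "?z a i = (\<Sum>j<m. ?y 0 j * ?z a j)"
    using sum_L_fixed[OF fz i] by simp
  also have "\<dots> \<le> (\<Sum>j\<le>a. real (a choose j) * \<tau> ^ j * ?s (a - j + 0))"
    unfolding \<tau>_def by (rule Suc.IH)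
  finally have "t * ?s b * ?z a i \<le> t * ?s b * (\<Sum>j\<le>a. real (a choose j) * \<tau> ^ j * ?s (a - j + 0))"
    by (rule mult_left_mono) (simp add: t s0)
  also have "\<dots> = (\<Sum>j\<le>a. real (a choose j) * \<tau> ^ j * (t * (?s (a - j) * ?s b)))"
    unfolding sum_distrib_left by (intro sum.cong refl) simp
  \<comment> \<open>Log-convexity merges the two moments into one of the total order; the factor
    \<open>?s 0 = L i i\<close> left over joins \<open>t\<close> to form another
    \<open>\<tau>\<close>.\<close>
  also have "\<dots> \<le> (\<Sum>j\<le>a. real (a choose j) * \<tau> ^ j * (t * (?s 0 * ?s (a - j + b))))"
  proof (intro sum_mono mult_left_mono)
    have "0 \<le> \<tau>" using s0[of 0] t by (simp add: \<tau>_def diag_moment_0)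
    then show "0 \<le> real (a choose j) * \<tau> ^ j" for j by simp
    show "?s (a - j) * ?s b \<le> ?s 0 * ?s (a - j + b)" for j
      using moment_mult_le[of "L i" c, OF row_fixed[OF i] c] by (simp add: moment_row[OF i])
  qed (rule t)
  also have "\<dots> = (\<Sum>j\<le>a. real (a choose j) * \<tau> ^ Suc j * ?s (a - j + b))"
    by (intro sum.cong refl) (simp add: \<tau>_def diag_moment_0)
  finally have second: "t * ?s b * ?z a i \<le> (\<Sum>j\<le>a. real (a choose j) * \<tau> ^ Suc j * ?s (a - j + b))" .
  \<comment> \<open>Pascal's rule joins the two bounds into the binomial sum for
    \<open>Suc a\<close>.\<close>
  have "(\<Sum>j\<le>a. real (a choose j) * \<tau> ^ j * ?s (a - j + Suc b))
      = (\<Sum>j\<le>Suc a. real (a choose j) * \<tau> ^ j * ?s (Suc a - j + b))"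
    by (simp add: Suc_diff_le)
  also have "\<dots> = ?s (Suc a + b) + (\<Sum>j\<le>a. real (a choose Suc j) * \<tau> ^ Suc j * ?s (a - j + b))"
    by (subst sum.atMost_Suc_shift) simp
  finally have "(\<Sum>j\<le>a. real (a choose j) * \<tau> ^ j * ?s (a - j + Suc b))
      + (\<Sum>j\<le>a. real (a choose j) * \<tau> ^ Suc j * ?s (a - j + b))
      = ?s (Suc a + b) + (\<Sum>j\<le>a. real (Suc a choose Suc j) * \<tau> ^ Suc j * ?s (a - j + b))"
    by (simp add: sum.distrib distrib_right del: power_Suc)
  also have "\<dots> = (\<Sum>j\<le>Suc a. real (Suc a choose j) * \<tau> ^ j * ?s (Suc a - j + b))"
    by (subst sum.atMost_Suc_shift) simp
  finally have "(\<Sum>j\<le>a. real (a choose j) * \<tau> ^ j * ?s (a - j + Suc b))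
      + (\<Sum>j\<le>a. real (a choose j) * \<tau> ^ Suc j * ?s (a - j + b))
      = (\<Sum>j\<le>Suc a. real (Suc a choose j) * \<tau> ^ j * ?s (Suc a - j + b))" .
  then show ?case
    unfolding step \<tau>_def[symmetric] using first second by simp
qed

text \<open>At \<open>b = 0\<close> the binomial bound is a convolution, so the exponential series
  releases a scalar factor whose exponent contains \<open>t * L i i\<close>, the norm of the
  rank-one update.\<close>

lemma rank_one_update_exp_le:
  assumes i: "i < m" and c: "\<And>l. l < m \<Longrightarrow> 0 \<le> c l" and t: "0 \<le> t" and "0 \<le> \<theta>"
  shows "(\<Sum>q<Q. \<theta> ^ q / fact q * diag_moment (c(i := c i + t)) i q)
    \<le> exp (\<theta> * (t * L i i)) * (\<Sum>q<Q. \<theta> ^ q / fact q * diag_moment c i q)"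
proof -
  let ?c' = "c(i := c i + t)"
  have s0: "0 \<le> diag_moment c i k" for k by (rule diag_moment_nonneg[OF i c])
  have "diag_moment ?c' i q
      \<le> (\<Sum>j\<le>q. real (q choose j) * (t * L i i) ^ j * diag_moment c i (q - j))" for q
    using rank_one_update_le[of i c t 0 q, OF i c t] sum_L_fixed[OF wop_pow_fixed[OF row_fixed[OF i]] i]
    by (simp add: diag_moment_def)
  then have "(\<Sum>q<Q. \<theta> ^ q / fact q * diag_moment ?c' i q)
      \<le> (\<Sum>q<Q. \<theta> ^ q / fact q * (\<Sum>j\<le>q. real (q choose j) * (t * L i i) ^ j * diag_moment c i (q - j)))"
    using \<open>0 \<le> \<theta>\<close> by (intro sum_mono mult_left_mono) auto
  also have "\<dots> \<le> exp (\<theta> * (t * L i i)) * (\<Sum>q<Q. \<theta> ^ q / fact q * diag_moment c i q)"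
    by (rule exp_sum_convolution_le[OF s0 _ \<open>0 \<le> \<theta>\<close>]) (use s0[of 0] t in \<open>simp add: diag_moment_0\<close>)
  finally show ?thesis .
qed

end

subsection \<open>Averaging over independent two-point weights\<close>

text \<open>
  The expectation of \<open>f X\<close>, where the coordinates of \<open>X\<close> in the list are independent, take values
  in \<open>{0, K i}\<close> and have mean \<open>w i\<close>, and the other coordinates are those of \<open>w\<close>.
\<close>

primrec avg :: "(nat \<Rightarrow> real) \<Rightarrow> nat list \<Rightarrow> ((nat \<Rightarrow> real) \<Rightarrow> real) \<Rightarrow> (nat \<Rightarrow> real) \<Rightarrow> real" where
  "avg K [] f w = f w"
| "avg K (i # js) f w =
     w i / K i * avg K js f (w(i := K i)) + (1 - w i / K i) * avg K js f (w(i := 0))"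

text \<open>All points at which \<open>avg\<close> evaluates its function, including those of
  probability zero.\<close>

definition vertices :: "(nat \<Rightarrow> real) \<Rightarrow> nat list \<Rightarrow> (nat \<Rightarrow> real) \<Rightarrow> (nat \<Rightarrow> real) set" where
  "vertices K js w = {X. \<forall>i. if i \<in> set js then X i = 0 \<or> X i = K i else X i = w i}"

lemma vertices_Cons:
  "X \<in> vertices K js (w(i := x)) \<Longrightarrow> x = 0 \<or> x = K i \<Longrightarrow> X \<in> vertices K (i # js) w"
  unfolding vertices_def by (auto split: if_splits)

lemma avg_mono:
  assumes "\<And>i. i \<in> set js \<Longrightarrow> 0 < K i \<and> 0 \<le> w i \<and> w i \<le> K i"
    and "\<And>X. X \<in> vertices K js w \<Longrightarrow> f X \<le> g X"
  shows "avg K js f w \<le> avg K js g w"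
  using assms
proof (induction js arbitrary: w)
  case Nil
  then show ?case using Nil(2)[of w] by (simp add: vertices_def)
next
  case (Cons i js)
  have le: "avg K js f (w(i := x)) \<le> avg K js g (w(i := x))" if "x = 0 \<or> x = K i" for x
  proof (rule Cons.IH)
    show "0 < K j \<and> 0 \<le> (w(i := x)) j \<and> (w(i := x)) j \<le> K j" if "j \<in> set js" for j
      using Cons.prems(1)[of j] Cons.prems(1)[of i] \<open>x = 0 \<or> x = K i\<close> that by auto
    show "f X \<le> g X" if "X \<in> vertices K js (w(i := x))" for X
      using Cons.prems(2) vertices_Cons that \<open>x = 0 \<or> x = K i\<close> by blast
  qed
  show ?case
    unfolding avg.simps using Cons.prems(1)[of i] le
    by (intro add_mono mult_left_mono) simp_all
qed

lemma avg_cong: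
  "(\<And>X. X \<in> vertices K js w \<Longrightarrow> f X = g X) \<Longrightarrow> avg K js f w = avg K js g w"
proof (induction js arbitrary: w)
  case Nil
  then show ?case using Nil(1)[of w] by (simp add: vertices_def)
next
  case (Cons i js)
  have "avg K js f (w(i := x)) = avg K js g (w(i := x))" if "x = 0 \<or> x = K i" for x
    by (rule Cons.IH) (use Cons.prems vertices_Cons that in blast)
  then show ?case by simp
qed

lemma avg_const [simp]: "avg K js (\<lambda>_. c) w = c"
  by (induction js arbitrary: w) (simp_all add: algebra_simps)

lemma avg_add: "avg K js (\<lambda>X. f X + g X) w = avg K js f w + avg K js g w"
  by (induction js arbitrary: w) (simp_all add: algebra_simps)

lemma avg_cmult: "avg K js (\<lambda>X. c * f X) w = c * avg K js f w"
  by (induction js arbitrary: w) (simp_all add: algebra_simps)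

lemma avg_sum: "avg K js (\<lambda>X. \<Sum>l\<in>A. f l X) w = (\<Sum>l\<in>A. avg K js (f l) w)"
  by (induction A rule: infinite_finite_induct) (simp_all add: avg_add)

lemma avg_coord: "(\<And>i. i \<in> set js \<Longrightarrow> K i \<noteq> 0) \<Longrightarrow> avg K js (\<lambda>X. X l) w = w l"
proof (induction js arbitrary: w)
  case (Cons i js)
  then have "avg K js (\<lambda>X. X l) (w(i := x)) = (w(i := x)) l" for x by simp
  then show ?case using Cons.prems[of i] by (auto simp: algebra_simps)
qed simp

text \<open>Two-point averages over different coordinates commute, so the one for \<open>i\<close>
  can be taken first wherever \<open>i\<close> stands in the list. In particular \<open>avg\<close>
  is affine in \<open>w i\<close>.\<close>

lemma avg_affine:
  assumes "i \<in> set js" "\<And>i. i \<in> set js \<Longrightarrow> K i \<noteq> 0"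
  shows "avg K js f w =
    w i / K i * avg K js f (w(i := K i)) + (1 - w i / K i) * avg K js f (w(i := 0))"
  using assms
proof (induction js arbitrary: w)
  case (Cons j js)
  show ?case
  proof (cases "j = i")
    case True
    then have "K i \<noteq> 0" using Cons.prems by simp
    then show ?thesis
      unfolding True avg.simps fun_upd_upd fun_upd_same by simp
  next
    case False
    then have "i \<in> set js" using Cons.prems by simp
    then have IH: "avg K js f v = v i / K i * avg K js f (v(i := K i))
        + (1 - v i / K i) * avg K js f (v(i := 0))" for v
      by (rule Cons.IH) (use Cons.prems(2) in simp)
    have twist: "w(i := x, j := y) = w(j := y, i := x)" for x y
      by (rule fun_upd_twist) (use False in simp)
    have other: "(w(i := x)) j = w j" for x
      using False by simp
    have e: "avg K js f (w(j := x)) = w i / K i * avg K js f (w(i := K i, j := x))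
        + (1 - w i / K i) * avg K js f (w(i := 0, j := x))" for x
      unfolding twist using IH[of "w(j := x)"] False by simp
    have "r * (s * a + (1 - s) * b) + (1 - r) * (s * c + (1 - s) * d)
        = s * (r * a + (1 - r) * c) + (1 - s) * (r * b + (1 - r) * d)" for a b c d r s :: real
      by (simp add: algebra_simps)
    then show ?thesis
      unfolding avg.simps other e .
  qed
qed simp

text \<open>A move keeps the mean of the weight, as
  \<open>p * (w i / p) + (1 - p) * 0 = w i\<close>, and \<open>avg\<close> is affine in that
  weight.\<close>

lemma avg_martingale:
  assumes "i \<in> set js" "\<And>i. i \<in> set js \<Longrightarrow> K i \<noteq> 0" "p \<noteq> 0"
  shows "p * avg K js f (w(i := w i / p)) + (1 - p) * avg K js f (w(i := 0)) = avg K js f w"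
proof -
  have "avg K js f (w(i := w i / p)) = w i / p / K i * avg K js f (w(i := K i))
      + (1 - w i / p / K i) * avg K js f (w(i := 0))"
    using avg_affine[OF assms(1,2), where w="w(i := w i / p)"] by simp
  moreover have "p * (s / p / k * a + (1 - s / p / k) * b) + (1 - p) * b = s / k * a + (1 - s / k) * b"
    for s k a b :: real
    using assms(3) by (simp add: algebra_simps)
  ultimately show ?thesis
    by (simp only: avg_affine[OF assms(1,2), where w=w and f=f])
qed

lemma avg_update:
  "i \<notin> set js \<Longrightarrow> avg K js (\<lambda>X. f (X(i := x))) (w(i := y)) = avg K js f (w(i := x))"
proof (induction js arbitrary: w)
  case (Cons j js)
  then have ij: "i \<noteq> j" and i: "i \<notin> set js" by auto
  show ?case
    unfolding avg.simps fun_upd_twist[OF ij] Cons.IH[OF i]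
    using ij by simp
qed simp

text \<open>The product \<open>X i * f X\<close> sees only the outcome \<open>X i = K i\<close>; its
  probability \<open>w i / K i\<close> times the value \<open>K i\<close> is
  \<open>w i\<close>.\<close>

lemma avg_size_bias:
  assumes "distinct js" "i \<in> set js" "\<And>i. i \<in> set js \<Longrightarrow> K i \<noteq> 0"
  shows "avg K js (\<lambda>X. X i * f X) w = w i * avg K js (\<lambda>X. f (X(i := K i))) w"
  using assms
proof (induction js arbitrary: w)
  case (Cons j js)
  show ?case
  proof (cases "j = i")
    case True
    then have i: "i \<notin> set js" using Cons.prems by simp
    have coord: "avg K js (\<lambda>X. X i * f X) (w(i := x)) = x * avg K js f (w(i := x))" for x
      unfolding avg_cmult[symmetric]
      by (rule avg_cong) (use i in \<open>auto simp: vertices_def\<close>)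
    show ?thesis
      using Cons.prems(2,3) unfolding True avg.simps coord avg_update[OF i]
      by (simp add: algebra_simps)
  next
    case False
    with Cons show ?thesis by (simp add: algebra_simps)
  qed
qed simp

subsection \<open>The potential\<close>

lemma power_ge_tangent:
  fixes x y :: real
  assumes "0 \<le> x" "0 \<le> y"
  shows "x ^ q + real q * x ^ (q - 1) * (y - x) \<le> y ^ q"
proof (induction q)
  case (Suc q)
  have "x * (y - x) \<le> y * (y - x)"
    using zero_le_square[of "y - x"] by (simp add: algebra_simps)
  then have "real q * x ^ (q - 1) * (x * (y - x)) \<le> real q * x ^ (q - 1) * (y * (y - x))"
    using assms(1) by (intro mult_left_mono) auto
  \<comment> \<open>At \<open>q = 0\<close> the exponent \<open>q - 1\<close> is cut off at zero,
    which the factor \<open>real q\<close> makes harmless.\<close>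
  moreover have "real q * x ^ (q - 1) * (x * (y - x)) = real q * x ^ q * (y - x)"
    by (cases q) auto
  ultimately have "x ^ Suc q + real (Suc q) * x ^ (Suc q - 1) * (y - x)
      \<le> y * (x ^ q + real q * x ^ (q - 1) * (y - x))"
    by (simp add: algebra_simps)
  also have "\<dots> \<le> y ^ Suc q"
    using mult_left_mono[OF Suc.IH assms(2)] by simp
  finally show ?case .
qed simp

text \<open>Jensen's inequality, from the tangent to the power function at the mean.\<close>

lemma avg_power_ge:
  assumes "\<And>i. i \<in> set js \<Longrightarrow> 0 < K i \<and> 0 \<le> w i \<and> w i \<le> K i"
    and "\<And>X. X \<in> vertices K js w \<Longrightarrow> 0 \<le> f X"
  shows "(avg K js f w) ^ q \<le> avg K js (\<lambda>X. f X ^ q) w"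
proof -
  let ?x = "avg K js f w"
  have "0 \<le> ?x"
    using avg_mono[OF assms(1), where f="\<lambda>_. 0" and g=f] assms(2) by simp
  have "?x ^ q = avg K js (\<lambda>X. (?x ^ q - real q * ?x ^ (q - 1) * ?x) + (real q * ?x ^ (q - 1)) * f X) w"
    by (simp only: avg_add avg_cmult avg_const)
  also have "\<dots> \<le> avg K js (\<lambda>X. f X ^ q) w"
    by (rule avg_mono[OF assms(1)])
      (use power_ge_tangent[OF \<open>0 \<le> ?x\<close> assms(2), where q=q] in \<open>simp_all add: algebra_simps\<close>)
  finally show ?thesis .
qed

text \<open>Differentiating the truncated series drops one term, so \<open>Suc Q\<close> terms in
  the conclusion face \<open>Q\<close> terms in the hypothesis. The logarithmic derivative is at
  most \<open>r\<close>, hence the sum times \<open>exp (- (r * x))\<close> does not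
  increase.\<close>

lemma exp_poly_gronwall:
  fixes G :: "nat \<Rightarrow> real"
  assumes G: "\<And>q. 0 \<le> G q" and r: "0 \<le> r" and T: "0 \<le> T"
    and step: "\<And>x. 0 \<le> x \<Longrightarrow> x \<le> T \<Longrightarrow>
      (\<Sum>q<Q. x ^ q / fact q * G (Suc q)) \<le> r * (\<Sum>q<Q. x ^ q / fact q * G q)"
  shows "(\<Sum>q<Suc Q. T ^ q / fact q * G q) \<le> G 0 * exp (r * T)"
proof -
  define Z where "Z = (\<lambda>x. \<Sum>q<Suc Q. x ^ q / fact q * G q)"
  have deriv: "((\<lambda>x. \<Sum>q<Suc N. x ^ q / fact q * G q) has_real_derivative
      (\<Sum>q<N. x ^ q / fact q * G (Suc q))) (at x)" for N x
  proof (induction N)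
    case (Suc N)
    have "((\<lambda>x. x ^ Suc N * (G (Suc N) / fact (Suc N))) has_real_derivative
        real (Suc N) * x ^ N * (G (Suc N) / fact (Suc N))) (at x)"
      by (rule DERIV_cmult_right) (use DERIV_pow[of "Suc N" x UNIV] in simp)
    moreover have "real (Suc N) * x ^ N * (G (Suc N) / fact (Suc N)) = x ^ N / fact N * G (Suc N)"
      unfolding fact_Suc by (simp del: of_nat_Suc)
    ultimately have "((\<lambda>x. x ^ Suc N / fact (Suc N) * G (Suc N)) has_real_derivative
        x ^ N / fact N * G (Suc N)) (at x)"
      by (simp only: times_divide_eq_left times_divide_eq_right)
    from DERIV_add[OF Suc this] show ?case by simp
  qed simp
  have "Z T * exp (- (r * T)) \<le> Z 0 * exp (- (r * 0))"
  proof (rule DERIV_nonpos_imp_nonincreasing[OF T])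
    fix x assume x: "0 \<le> x" "x \<le> T"
    let ?D = "\<Sum>q<Q. x ^ q / fact q * G (Suc q)"
    have "((\<lambda>x. Z x * exp (- (r * x))) has_real_derivative
        ?D * exp (- (r * x)) + Z x * (exp (- (r * x)) * - r)) (at x)"
      unfolding Z_def by (rule derivative_eq_intros deriv refl | simp)+
    moreover have "?D * exp (- (r * x)) + Z x * (exp (- (r * x)) * - r) = (?D - r * Z x) * exp (- (r * x))"
      by (simp add: algebra_simps)
    moreover have "?D \<le> r * Z x"
    proof -
      have "?D \<le> r * (\<Sum>q<Q. x ^ q / fact q * G q)" by (rule step[OF x])
      also have "\<dots> \<le> r * Z x"
        unfolding Z_def using r G x by (intro mult_left_mono) auto
      finally show ?thesis .
    qed
    ultimately show "\<exists>y. ((\<lambda>x. Z x * exp (- (r * x))) has_real_derivative y) (at x) \<and> y \<le> 0"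
      by (metis diff_le_0_iff_le exp_ge_zero mult_nonpos_nonneg)
  qed
  moreover have "Z 0 = G 0"
    unfolding Z_def by (subst sum.lessThan_Suc_shift) simp
  ultimately have "Z T * exp (- (r * T)) \<le> G 0" by simp
  then show ?thesis
    by (simp add: Z_def exp_minus field_simps del: sum.lessThan_Suc)
qed

section \<open>The averaged exponential trace\<close>

locale game_kernel = projection_kernel +
  fixes \<delta> :: real
  assumes \<delta>_pos: "0 < \<delta>"
begin

text \<open>The indices that matter for the game, with \<open>\<delta> = 1 / \<alpha>\<close>. If
  \<open>L i i = 0\<close>, the whole row of \<open>L\<close> vanishes; if
  \<open>L i i > \<delta>\<close>, no move at weight one is legal.\<close>

definition active :: "nat list" where
  "active = filter (\<lambda>i. 0 < L i i \<and> L i i \<le> \<delta>) [0..<m]"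

text \<open>The largest weight that a legal move can give to an active index.\<close>

definition cap :: "nat \<Rightarrow> real" where
  "cap i = \<delta> / L i i"

text \<open>A shift that makes both \<open>shift + X\<close> and \<open>shift - X\<close> nonnegative at all vertices \<open>X\<close>.\<close>

definition shift :: real where
  "shift = 1 + (\<Sum>i\<in>set active. cap i)"

text \<open>
  The expectation of the trace of \<open>exp (\<theta> * (shift * L + \<sigma> * L * diag X * L))\<close> on the range of \<open>L\<close>,
  with the exponential series truncated, so that no matrix exponential is needed.
\<close>

definition potential :: "real \<Rightarrow> real \<Rightarrow> nat \<Rightarrow> (nat \<Rightarrow> real) \<Rightarrow> real" where
  "potential \<sigma> \<theta> Q = avg cap active
     (\<lambda>X. \<Sum>q<Q. \<theta> ^ q / fact q * trace_moment (\<lambda>l. shift + \<sigma> * X l) q)"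

definition feasible :: "(nat \<Rightarrow> real) \<Rightarrow> bool" where
  "feasible w \<longleftrightarrow> (\<forall>i. if i \<in> set active then 0 \<le> w i \<and> w i \<le> cap i else w i = 1)"

lemma set_active: "i \<in> set active \<longleftrightarrow> i < m \<and> 0 < L i i \<and> L i i \<le> \<delta>"
  by (auto simp: active_def)

lemma distinct_active: "distinct active"
  by (simp add: active_def)

lemma cap_ge_1: "i \<in> set active \<Longrightarrow> 1 \<le> cap i"
  by (simp add: set_active cap_def)

lemma cap_pos: "i \<in> set active \<Longrightarrow> 0 < cap i"
  using cap_ge_1 by force

lemma cap_nonzero: "i \<in> set active \<Longrightarrow> cap i \<noteq> 0"
  using cap_pos by force

lemma shift_ge_1: "1 \<le> shift"
  unfolding shift_def using cap_pos by (simp add: sum_nonneg less_imp_le)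

lemma cap_le_shift: "i \<in> set active \<Longrightarrow> cap i \<le> shift"
  unfolding shift_def using cap_pos member_le_sum[of i "set active" cap]
  by (fastforce simp: less_imp_le)

lemma feasibleD: "feasible w \<Longrightarrow> i \<in> set active \<Longrightarrow> 0 < cap i \<and> 0 \<le> w i \<and> w i \<le> cap i"
  using cap_pos unfolding feasible_def by meson

lemma feasible_1: "feasible (\<lambda>_. 1)"
  using cap_ge_1 by (simp add: feasible_def)

lemma feasible_bounds: "feasible w \<Longrightarrow> 0 \<le> w i \<and> w i \<le> shift"
  using shift_ge_1 cap_le_shift[of i] unfolding feasible_def
  by (auto dest!: spec[of _ i] split: if_splits)

lemma vertices_feasible: "feasible w \<Longrightarrow> X \<in> vertices cap active w \<Longrightarrow> feasible X"
  using cap_pos unfolding feasible_def vertices_def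
  by (fastforce split: if_splits)

lemma shifted_nonneg:
  assumes "\<sigma> \<in> {1, -1}" "feasible X"
  shows "0 \<le> shift + \<sigma> * X l"
  using feasible_bounds[OF assms(2), of l] assms(1) shift_ge_1 by auto

lemma trace_moment_nonneg: "(\<And>l. l < m \<Longrightarrow> 0 \<le> c l) \<Longrightarrow> 0 \<le> trace_moment c q"
  unfolding trace_moment_def by (intro sum_nonneg diag_moment_nonneg) auto

lemma potential_nonneg:
  assumes "\<sigma> \<in> {1, -1}" "0 \<le> \<theta>" "feasible w"
  shows "0 \<le> potential \<sigma> \<theta> Q w"
proof -
  have "avg cap active (\<lambda>_. 0) w \<le> potential \<sigma> \<theta> Q w"
    unfolding potential_def
    by (intro avg_mono feasibleD[OF assms(3)] sum_nonneg mult_nonneg_nonneg trace_moment_nonneg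
        shifted_nonneg[OF assms(1)] vertices_feasible[OF assms(3)])
      (use assms(2) in auto)
  then show ?thesis by simp
qed

lemma potential_martingale:
  assumes "i \<in> set active" "0 < p"
  shows "p * potential \<sigma> \<theta> Q (w(i := w i / p)) + (1 - p) * potential \<sigma> \<theta> Q (w(i := 0))
    = potential \<sigma> \<theta> Q w"
  unfolding potential_def using assms by (intro avg_martingale cap_nonzero) auto

text \<open>The Rayleigh quotient of \<open>v\<close> is affine in \<open>X\<close>, so its average
  is its value at \<open>w\<close>, which is at least \<open>b\<close>. Jensen's inequality brings
  the powers inside the average, where the trace dominates them.\<close>

lemma potential_ge:
  assumes \<sigma>: "\<sigma> \<in> {1, -1}" and \<theta>: "0 \<le> \<theta>" and w: "feasible w"
    and v: "v \<in> fixed" "0 < (\<Sum>l<m. v l * v l)"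
    and b: "0 \<le> b" "b * (\<Sum>l<m. v l * v l) \<le> (\<Sum>l<m. (shift + \<sigma> * w l) * v l * v l)"
  shows "(\<Sum>q<Q. (\<theta> * b) ^ q / fact q) \<le> potential \<sigma> \<theta> Q w"
proof -
  let ?\<rho> = "\<Sum>l<m. v l * v l"
  define f where "f = (\<lambda>X. (\<Sum>l<m. (shift + \<sigma> * X l) * v l * v l) / ?\<rho>)"
  have f: "f X = (\<Sum>l<m. shift * v l * v l) / ?\<rho> + (\<Sum>l<m. (\<sigma> * v l * v l / ?\<rho>) * X l)" for X
    unfolding f_def by (simp add: sum.distrib add_divide_distrib sum_divide_distrib algebra_simps)
  have "avg cap active f w = f w"
    unfolding f by (simp only: avg_add avg_const avg_sum avg_cmult avg_coord[OF cap_nonzero])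
  have f0: "0 \<le> f X" if "X \<in> vertices cap active w" for X
    unfolding f_def using v(2) shifted_nonneg[OF \<sigma> vertices_feasible[OF w that]]
    by (intro divide_nonneg_nonneg sum_nonneg) (auto simp: mult.assoc)
  have "b \<le> f w"
    using b(2) v(2) by (simp add: f_def pos_le_divide_eq)
  have "b ^ q \<le> avg cap active (\<lambda>X. trace_moment (\<lambda>l. shift + \<sigma> * X l) q) w" for q
  proof -
    have "b ^ q \<le> (avg cap active f w) ^ q"
      using \<open>b \<le> f w\<close> b(1) \<open>avg cap active f w = f w\<close> by (simp add: power_mono)
    also have "\<dots> \<le> avg cap active (\<lambda>X. f X ^ q) w"
      by (rule avg_power_ge) (use feasibleD[OF w] f0 in auto)
    also have "\<dots> \<le> avg cap active (\<lambda>X. trace_moment (\<lambda>l. shift + \<sigma> * X l) q) w"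
      unfolding f_def
      by (intro avg_mono feasibleD[OF w] trace_moment_ge_power v
          shifted_nonneg[OF \<sigma>] vertices_feasible[OF w])
    finally show ?thesis .
  qed
  then have "(\<Sum>q<Q. \<theta> ^ q / fact q * b ^ q)
      \<le> (\<Sum>q<Q. \<theta> ^ q / fact q * avg cap active (\<lambda>X. trace_moment (\<lambda>l. shift + \<sigma> * X l) q) w)"
    using \<theta> by (intro sum_mono mult_left_mono) auto
  then show ?thesis
    unfolding potential_def avg_sum avg_cmult by (simp add: power_mult_distrib)
qed

text \<open>
  Since \<open>X l\<close> is zero or \<open>cap l\<close> and has mean one, weighting by \<open>X l\<close> amounts to setting \<open>X l\<close> to its
  maximum; this is a rank-one change of the operator, of norm at most \<open>\<delta>\<close>.
\<close>

lemma size_bias_step: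
  fixes Q :: nat
  assumes \<sigma>: "\<sigma> \<in> {1, -1}" and \<theta>: "0 \<le> \<theta>" and l: "l < m"
  defines "f \<equiv> \<lambda>X. \<Sum>q<Q. \<theta> ^ q / fact q * diag_moment (\<lambda>l. shift + \<sigma> * X l) l q"
  shows "\<sigma> * avg cap active (\<lambda>X. X l * f X) (\<lambda>_. 1)
    \<le> \<sigma> * exp (\<sigma> * (\<theta> * \<delta>)) * avg cap active f (\<lambda>_. 1)"
proof -
  let ?w = "\<lambda>_::nat. 1 :: real"
  have nonneg: "0 \<le> f X" if "feasible X" for X
    unfolding f_def using \<theta> l shifted_nonneg[OF \<sigma> that]
    by (intro sum_nonneg mult_nonneg_nonneg diag_moment_nonneg) auto
  have e1: "1 \<le> exp (\<theta> * \<delta>)" using \<theta> \<delta>_pos by simp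
  have mono: "avg cap active g ?w \<le> avg cap active h ?w" if "\<And>X. X \<in> vertices cap active ?w \<Longrightarrow> g X \<le> h X" for g h
    by (rule avg_mono[OF feasibleD[OF feasible_1] that])
  define A where "A = avg cap active f ?w"
  have "0 \<le> A"
    using mono[of "\<lambda>_. 0" f] nonneg vertices_feasible[OF feasible_1] by (simp add: A_def)
  show ?thesis
  proof (cases "l \<in> set active")
    case False
    \<comment> \<open>An inactive weight is one at every vertex; what remains is \<open>\<sigma>
      \<le> \<sigma> * exp (\<sigma> * (\<theta> * \<delta>))\<close>, true for both signs.\<close>
    have "avg cap active (\<lambda>X. X l * f X) ?w = A"
      unfolding A_def by (rule avg_cong) (use False in \<open>simp add: vertices_def\<close>)
    moreover have "\<sigma> \<le> \<sigma> * exp (\<sigma> * (\<theta> * \<delta>))"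
      using \<sigma> \<theta> \<delta>_pos by auto
    ultimately show ?thesis
      using mult_right_mono[OF _ \<open>0 \<le> A\<close>, of \<sigma> "\<sigma> * exp (\<sigma> * (\<theta> * \<delta>))"] by (simp add: A_def)
  next
    case True
    define B where "B = avg cap active (\<lambda>X. f (X(l := cap l))) ?w"
    have sb: "avg cap active (\<lambda>X. X l * f X) ?w = B"
      unfolding B_def using avg_size_bias[OF distinct_active True cap_nonzero, where w="?w"] by simp
    have \<delta>: "cap l * L l l = \<delta>" using True by (simp add: cap_def set_active)
    have upd: "(\<lambda>i. shift + \<sigma> * (X(l := x)) i) = (\<lambda>i. shift + \<sigma> * X i)(l := shift + \<sigma> * x)" for X x
      by (auto simp: fun_eq_iff)
    have feas: "feasible (X(l := cap l))" if "X \<in> vertices cap active ?w" for X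
      using vertices_feasible[OF feasible_1 that] cap_pos[OF True] True
      by (auto simp: feasible_def)
    have zero_or: "X l = 0 \<or> X l = cap l" if "X \<in> vertices cap active ?w" for X
      using that True by (auto simp: vertices_def)
    from \<sigma> consider "\<sigma> = 1" | "\<sigma> = -1" by auto
    then show ?thesis
    proof cases
      case 1
      \<comment> \<open>For the positive sign, size-biasing raises the shifted weight by
        \<open>cap l\<close> or leaves it alone. The update has norm
        \<open>cap l * L l l = \<delta>\<close>.\<close>
      have "f (X(l := cap l)) \<le> exp (\<theta> * \<delta>) * f X" if X: "X \<in> vertices cap active ?w" for X
      proof (cases "X l = cap l")
        case True
        then show ?thesis
          using mult_right_mono[OF e1 nonneg[OF vertices_feasible[OF feasible_1 X]]]
          by (metis fun_upd_triv mult_1)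
      next
        case False
        then have "X l = 0" using zero_or[OF X] by simp
        then have c: "(\<lambda>i. shift + \<sigma> * (X(l := cap l)) i)
            = (\<lambda>i. shift + \<sigma> * X i)(l := (\<lambda>i. shift + \<sigma> * X i) l + cap l)"
          by (auto simp: fun_eq_iff 1)
        have "(\<Sum>q<Q. \<theta> ^ q / fact q * diag_moment ((\<lambda>i. shift + \<sigma> * X i)
              (l := (\<lambda>i. shift + \<sigma> * X i) l + cap l)) l q)
            \<le> exp (\<theta> * (cap l * L l l)) *
              (\<Sum>q<Q. \<theta> ^ q / fact q * diag_moment (\<lambda>i. shift + \<sigma> * X i) l q)"
          by (rule rank_one_update_exp_le[OF l])
            (use shifted_nonneg[OF \<sigma> vertices_feasible[OF feasible_1 X]] cap_pos[OF \<open>l \<in> set active\<close>] \<theta> in auto)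
        then show ?thesis
          unfolding f_def c[symmetric] \<delta> .
      qed
      then have "B \<le> exp (\<theta> * \<delta>) * A"
        unfolding A_def B_def avg_cmult[symmetric] by (rule mono)
      then show ?thesis by (simp add: 1 sb A_def)
    next
      case 2
      \<comment> \<open>For the negative sign, raising \<open>X l\<close> lowers the shifted weight,
        so the update leads from \<open>X(l := cap l)\<close> back to \<open>X\<close>. This bounds
        \<open>B\<close> from below, as the factor -1 requires.\<close>
      have "f X \<le> exp (\<theta> * \<delta>) * f (X(l := cap l))" if X: "X \<in> vertices cap active ?w" for X
      proof (cases "X l = cap l")
        case True
        then show ?thesis
          using mult_right_mono[OF e1 nonneg[OF vertices_feasible[OF feasible_1 X]]]
          by (metis fun_upd_triv mult_1)
      next
        case False
        then have "X l = 0" using zero_or[OF X] by simp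
        then have c: "(\<lambda>i. shift + \<sigma> * X i)
            = (\<lambda>i. shift + \<sigma> * (X(l := cap l)) i)(l := (\<lambda>i. shift + \<sigma> * (X(l := cap l)) i) l + cap l)"
          by (auto simp: fun_eq_iff 2)
        have "(\<Sum>q<Q. \<theta> ^ q / fact q * diag_moment ((\<lambda>i. shift + \<sigma> * (X(l := cap l)) i)
              (l := (\<lambda>i. shift + \<sigma> * (X(l := cap l)) i) l + cap l)) l q)
            \<le> exp (\<theta> * (cap l * L l l)) *
              (\<Sum>q<Q. \<theta> ^ q / fact q * diag_moment (\<lambda>i. shift + \<sigma> * (X(l := cap l)) i) l q)"
          by (rule rank_one_update_exp_le[OF l])
            (use shifted_nonneg[OF \<sigma> feas[OF X]] cap_pos[OF \<open>l \<in> set active\<close>] \<theta> in auto)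
        then show ?thesis
          unfolding f_def c[symmetric] \<delta> .
      qed
      then have "A \<le> exp (\<theta> * \<delta>) * B"
        unfolding A_def B_def avg_cmult[symmetric] by (rule mono)
      then show ?thesis by (simp add: 2 sb A_def exp_minus field_simps)
    qed
  qed
qed

text \<open>By \<open>trace_moment_Suc\<close> and \<open>size_bias_step\<close> the averaged trace
  satisfies a linear differential inequality in \<open>\<theta>\<close>, up to truncation. The
  Gronwall bound starts from the trace of \<open>L\<close>, the value at zero.\<close>

lemma potential_init_le:
  assumes \<sigma>: "\<sigma> \<in> {1, -1}" and \<theta>: "0 \<le> \<theta>"
  shows "potential \<sigma> \<theta> (Suc Q) (\<lambda>_. 1)
    \<le> (\<Sum>i<m. L i i) * exp (\<theta> * (shift + \<sigma> * exp (\<sigma> * (\<theta> * \<delta>))))"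
proof -
  let ?w = "\<lambda>_::nat. 1 :: real"
  let ?c = "\<lambda>X l. shift + \<sigma> * X l"
  define G where "G = (\<lambda>q. avg cap active (\<lambda>X. trace_moment (?c X) q) ?w)"
  have G0: "0 \<le> G q" for q
  proof -
    have "avg cap active (\<lambda>_. 0) ?w \<le> G q"
      unfolding G_def
      by (intro avg_mono feasibleD[OF feasible_1] trace_moment_nonneg
          shifted_nonneg[OF \<sigma>] vertices_feasible[OF feasible_1])
    then show ?thesis by simp
  qed
  \<comment> \<open>The growth rate at \<open>x\<close>. It is nondecreasing for both signs, so its
    value at \<open>\<theta>\<close> serves on all of \<open>[0, \<theta>]\<close>.\<close>
  define r where "r = (\<lambda>x. shift + \<sigma> * exp (\<sigma> * (x * \<delta>)))"
  have r_mono: "r x \<le> r y" if "x \<le> y" for x y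
    using \<sigma> that \<delta>_pos by (auto simp: r_def)
  have r0: "0 \<le> r x" if "0 \<le> x" for x
  proof -
    have "0 \<le> r 0" using \<sigma> shift_ge_1 by (auto simp: r_def)
    then show ?thesis using r_mono[OF that] by linarith
  qed
  have step: "(\<Sum>q<Q. x ^ q / fact q * G (Suc q)) \<le> r \<theta> * (\<Sum>q<Q. x ^ q / fact q * G q)"
    if x: "0 \<le> x" "x \<le> \<theta>" for x
  proof -
    define f where "f = (\<lambda>l X. \<Sum>q<Q. x ^ q / fact q * diag_moment (?c X) l q)"
    have S: "(\<Sum>q<Q. x ^ q / fact q * G q) = (\<Sum>l<m. avg cap active (f l) ?w)"
    proof -
      have "(\<Sum>q<Q. x ^ q / fact q * G q) = avg cap active (\<lambda>X. \<Sum>q<Q. x ^ q / fact q * trace_moment (?c X) q) ?w"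
        unfolding G_def by (simp only: avg_sum avg_cmult)
      also have "(\<lambda>X. \<Sum>q<Q. x ^ q / fact q * trace_moment (?c X) q) = (\<lambda>X. \<Sum>l<m. f l X)"
        unfolding f_def trace_moment_def sum_distrib_left by (subst sum.swap) simp
      finally show ?thesis by (simp only: avg_sum)
    qed
    have "(\<Sum>q<Q. x ^ q / fact q * G (Suc q))
        = avg cap active (\<lambda>X. \<Sum>q<Q. x ^ q / fact q * trace_moment (?c X) (Suc q)) ?w"
      unfolding G_def by (simp only: avg_sum avg_cmult)
    also have "(\<lambda>X. \<Sum>q<Q. x ^ q / fact q * trace_moment (?c X) (Suc q))
        = (\<lambda>X. \<Sum>l<m. shift * f l X + \<sigma> * (X l * f l X))"
    proof
      fix X
      have "(\<Sum>q<Q. x ^ q / fact q * trace_moment (?c X) (Suc q))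
          = (\<Sum>l<m. \<Sum>q<Q. x ^ q / fact q * (?c X l * diag_moment (?c X) l q))"
        unfolding trace_moment_Suc sum_distrib_left by (rule sum.swap)
      also have "\<dots> = (\<Sum>l<m. ?c X l * f l X)"
        unfolding f_def sum_distrib_left by (intro sum.cong refl) simp
      finally show "(\<Sum>q<Q. x ^ q / fact q * trace_moment (?c X) (Suc q))
          = (\<Sum>l<m. shift * f l X + \<sigma> * (X l * f l X))"
        by (simp add: algebra_simps)
    qed
    also have "avg cap active \<dots> ?w
        = (\<Sum>l<m. shift * avg cap active (f l) ?w + \<sigma> * avg cap active (\<lambda>X. X l * f l X) ?w)"
      by (simp only: avg_sum avg_add avg_cmult)
    also have "\<dots> \<le> (\<Sum>l<m. shift * avg cap active (f l) ?w
        + \<sigma> * exp (\<sigma> * (x * \<delta>)) * avg cap active (f l) ?w)"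
      unfolding f_def by (intro sum_mono add_left_mono size_bias_step[OF \<sigma> x(1)]) simp
    also have "\<dots> = r x * (\<Sum>q<Q. x ^ q / fact q * G q)"
      unfolding S by (simp add: sum_distrib_left r_def algebra_simps)
    also have "\<dots> \<le> r \<theta> * (\<Sum>q<Q. x ^ q / fact q * G q)"
      by (rule mult_right_mono[OF r_mono[OF x(2)]]) (use G0 x in \<open>simp add: sum_nonneg\<close>)
    finally show ?thesis .
  qed
  have "potential \<sigma> \<theta> (Suc Q) ?w = (\<Sum>q<Suc Q. \<theta> ^ q / fact q * G q)"
    unfolding potential_def G_def by (simp only: avg_sum avg_cmult)
  also have "\<dots> \<le> G 0 * exp (r \<theta> * \<theta>)"
    by (rule exp_poly_gronwall[OF G0 r0[OF \<theta>] \<theta> step])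
  also have "G 0 = (\<Sum>i<m. L i i)"
    by (simp add: G_def trace_moment_def diag_moment_0)
  finally show ?thesis by (simp add: r_def mult.commute)
qed

end

subsection \<open>The pseudoinverse of a symmetric matrix\<close>

lemma square_sum_zero_imp_zero:
  fixes A :: "real mat"
  assumes A: "A \<in> carrier_mat nr nc" and 0: "transpose_mat A * A = 0\<^sub>m nc nc"
  shows "A = 0\<^sub>m nr nc"
proof (rule eq_matI)
  fix i j assume ij: "i < dim_row (0\<^sub>m nr nc)" "j < dim_col (0\<^sub>m nr nc)"
  have "(transpose_mat A * A) $$ (j, j) = (\<Sum>k<nr. (A $$ (k, j))\<^sup>2)"
    using A ij by (simp add: scalar_prod_def power2_eq_square atLeast0LessThan)
  then have "(\<Sum>k<nr. (A $$ (k, j))\<^sup>2) = 0"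
    using 0 ij by simp
  then have "(A $$ (i, j))\<^sup>2 = 0"
    by (subst (asm) sum_nonneg_eq_0_iff) (use ij in auto)
  then show "A $$ (i, j) = 0\<^sub>m nr nc $$ (i, j)" using ij by simp
qed (use A in auto)

text \<open>The transpose of \<open>M * P\<close> times \<open>M * P\<close> contains the factor
  \<open>M * (M * P)\<close> and vanishes, so all columns of \<open>M * P\<close> have norm
  zero.\<close>

lemma symmetric_mult_cancel:
  fixes M :: "real mat"
  assumes M: "M \<in> carrier_mat n n" "transpose_mat M = M" and P: "P \<in> carrier_mat n n"
    and 0: "M * (M * P) = 0\<^sub>m n n"
  shows "M * P = 0\<^sub>m n n"
proof (rule square_sum_zero_imp_zero)
  have "transpose_mat (M * P) * (M * P) = transpose_mat P * M * (M * P)"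
    using M P by (simp add: transpose_mult[of _ n n])
  also have "\<dots> = transpose_mat P * (M * (M * P))"
    using M P by (intro assoc_mult_mat[of _ n n _ n _ n]) auto
  also have "\<dots> = 0\<^sub>m n n"
    unfolding 0 using P by simp
  finally show "transpose_mat (M * P) * (M * P) = 0\<^sub>m n n" .
qed (use M P in auto)

text \<open>Horner's scheme with the constant coefficient first, so that removing the head of the
  list removes the lowest-order term.\<close>

primrec poly_mat :: "real mat \<Rightarrow> real list \<Rightarrow> real mat" where
  "poly_mat M [] = 0\<^sub>m (dim_row M) (dim_row M)"
| "poly_mat M (c # cs) = c \<cdot>\<^sub>m 1\<^sub>m (dim_row M) + M * poly_mat M cs"

lemma poly_mat_carrier: "M \<in> carrier_mat n n \<Longrightarrow> poly_mat M cs \<in> carrier_mat n n"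
  by (induction cs) auto

lemma poly_mat_commute:
  assumes M: "M \<in> carrier_mat n n"
  shows "poly_mat M cs * M = M * poly_mat M cs"
proof (induction cs)
  case Nil
  then show ?case using M by simp
next
  case (Cons c cs)
  let ?P = "poly_mat M cs"
  have P: "?P \<in> carrier_mat n n" by (rule poly_mat_carrier[OF M])
  have "(c \<cdot>\<^sub>m 1\<^sub>m n + M * ?P) * M = c \<cdot>\<^sub>m M + M * (M * ?P)"
    using M P Cons by (simp add: add_mult_distrib_mat[of _ n n _ _ n] mult_smult_assoc_mat[of _ n n _ n])
  also have "\<dots> = M * (c \<cdot>\<^sub>m 1\<^sub>m n + M * ?P)"
    using M P by (simp add: mult_add_distrib_mat[of _ n n _ n] mult_smult_distrib[of _ n n _ n])
  finally show ?case using M by simp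
qed

lemma poly_mat_symmetric:
  assumes M: "M \<in> carrier_mat n n" "transpose_mat M = M"
  shows "transpose_mat (poly_mat M cs) = poly_mat M cs"
proof (induction cs)
  case Nil
  then show ?case by simp
next
  case (Cons c cs)
  let ?P = "poly_mat M cs"
  have P: "?P \<in> carrier_mat n n" by (rule poly_mat_carrier[OF M(1)])
  have "transpose_mat (c \<cdot>\<^sub>m 1\<^sub>m n) = c \<cdot>\<^sub>m 1\<^sub>m n"
    by (rule eq_matI) auto
  then have "transpose_mat (c \<cdot>\<^sub>m 1\<^sub>m n + M * ?P) = c \<cdot>\<^sub>m 1\<^sub>m n + ?P * M"
    using M P Cons by (simp add: transpose_add[of _ n n] transpose_mult[of _ n n])
  then show ?case using M by (simp add: poly_mat_commute[OF M(1)])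
qed

lemma poly_mat_index:
  assumes M: "M \<in> carrier_mat n n" and ij: "i < n" "j < n"
  shows "poly_mat M cs $$ (i, j) = (\<Sum>k<length cs. cs ! k * (((*) M ^^ k) (1\<^sub>m n)) $$ (i, j))"
  using ij(1)
proof (induction cs arbitrary: i)
  case Nil
  then show ?case using M ij by simp
next
  case (Cons c cs)
  let ?W = "\<lambda>k. ((*) M ^^ k) (1\<^sub>m n)"
  have W: "?W k \<in> carrier_mat n n" for k
    using M by (induction k) auto
  have P: "poly_mat M cs \<in> carrier_mat n n" by (rule poly_mat_carrier[OF M])
  have mult: "(M * A) $$ (i, j) = (\<Sum>l<n. M $$ (i, l) * A $$ (l, j))" if "A \<in> carrier_mat n n" for A
    using M that Cons.prems ij by (simp add: scalar_prod_def atLeast0LessThan)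
  have "(M * poly_mat M cs) $$ (i, j) = (\<Sum>l<n. M $$ (i, l) * (\<Sum>k<length cs. cs ! k * ?W k $$ (l, j)))"
    by (simp add: mult[OF P] Cons.IH)
  also have "\<dots> = (\<Sum>k<length cs. cs ! k * (\<Sum>l<n. M $$ (i, l) * ?W k $$ (l, j)))"
    unfolding sum_distrib_left by (subst sum.swap) (simp add: mult_ac)
  also have "\<dots> = (\<Sum>k<length cs. cs ! k * ?W (Suc k) $$ (i, j))"
    by (simp add: mult[OF W])
  finally have "(M * poly_mat M cs) $$ (i, j) = (\<Sum>k<length cs. cs ! k * ?W (Suc k) $$ (i, j))" .
  then show ?case
    using M P Cons.prems ij by (simp add: sum.lessThan_Suc_shift del: sum.lessThan_Suc funpow.simps(2))
qed

text \<open>The first \<open>n * n + 1\<close> powers of \<open>M\<close> lie in a space of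
  dimension \<open>n * n\<close> and are therefore linearly dependent.\<close>

lemma annihilating_poly_mat:
  assumes M: "M \<in> carrier_mat n n"
  shows "\<exists>cs. (\<exists>c\<in>set cs. c \<noteq> 0) \<and> poly_mat M cs = 0\<^sub>m n n"
proof -
  define N where "N = Suc (n * n)"
  let ?W = "\<lambda>k. ((*) M ^^ k) (1\<^sub>m n)"
  \<comment> \<open>Column \<open>k\<close> of \<open>A\<close> will list the entries of
    \<open>M ^ k\<close> in row-major order; a zero row at index \<open>n * n\<close> makes
    \<open>A\<close> square and singular, and a kernel vector gives the coefficients.\<close>
  define r where "r = (\<lambda>i. vec N (\<lambda>k. ?W k $$ (i div n, i mod n)))"
  define A where "A = mat\<^sub>r N N (\<lambda>i. if i = n * n then 0\<^sub>v N else r i)"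
  have "det A = 0"
    unfolding A_def by (rule det_row_0) (auto simp: N_def r_def)
  moreover have A: "A \<in> carrier_mat N N" by (simp add: A_def)
  ultimately obtain v where v: "v \<in> carrier_vec N" "v \<noteq> 0\<^sub>v N" "A *\<^sub>v v = 0\<^sub>v N"
    using det_0_iff_vec_prod_zero by blast
  define cs where "cs = map (\<lambda>k. v $ k) [0..<N]"
  have "\<exists>c\<in>set cs. c \<noteq> 0"
    using v(1,2) by (auto simp: cs_def)
  moreover have "poly_mat M cs = 0\<^sub>m n n"
  proof (rule eq_matI)
    fix i j assume "i < dim_row (0\<^sub>m n n)" "j < dim_col (0\<^sub>m n n)"
    then have ij: "i < n" "j < n" by auto
    define k where "k = i * n + j"
    have "k < n * n"
    proof -
      have "i * n + j < (i + 1) * n" using ij by simp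
      also have "\<dots> \<le> n * n" using ij by (intro mult_right_mono) auto
      finally show ?thesis by (simp add: k_def)
    qed
    have "k div n = i" "k mod n = j" using ij by (auto simp: k_def)
    have "(A *\<^sub>v v) $ k = 0"
      using v(3) \<open>k < n * n\<close> by (simp add: N_def)
    moreover have "(A *\<^sub>v v) $ k = (\<Sum>l<N. ?W l $$ (i, j) * v $ l)"
      using A v(1) \<open>k < n * n\<close> \<open>k div n = i\<close> \<open>k mod n = j\<close>
      by (simp add: A_def N_def r_def scalar_prod_def atLeast0LessThan del: sum.lessThan_Suc)
    ultimately show "poly_mat M cs $$ (i, j) = 0\<^sub>m n n $$ (i, j)"
      using ij by (simp add: poly_mat_index[OF M] cs_def mult.commute)
  qed (use poly_mat_carrier[OF M, of cs] in auto)
  ultimately show ?thesis by blast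
qed

text \<open>
  A polynomial annihilating \<open>M\<close>, solved for its lowest-order term, gives \<open>M ^ k = M ^ Suc k * R\<close> with \<open>R\<close>
  a polynomial in \<open>M\<close>; by symmetry of \<open>M\<close> the common powers cancel down to \<open>M = M * M * R\<close>.
\<close>

lemma symmetric_generalized_inverse:
  fixes M :: "real mat"
  assumes M: "M \<in> carrier_mat n n" "transpose_mat M = M"
  obtains R where "R \<in> carrier_mat n n" "transpose_mat R = R" "R * M = M * R" "M * (M * R) = M"
proof -
  have step: "\<exists>ds d. M * (M * (d \<cdot>\<^sub>m poly_mat M ds)) = M"
    if "M * poly_mat M cs = 0\<^sub>m n n" "\<exists>c\<in>set cs. c \<noteq> 0" for cs
    using that
  proof (induction cs)
    case (Cons c cs)
    let ?P = "poly_mat M cs"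
    have P: "?P \<in> carrier_mat n n" by (rule poly_mat_carrier[OF M(1)])
    have eq: "c \<cdot>\<^sub>m M + M * (M * ?P) = 0\<^sub>m n n"
      using Cons.prems(1) M P
      by (simp add: mult_add_distrib_mat[of _ n n _ n] mult_smult_distrib[of _ n n _ n])
    show ?case
    proof (cases "c = 0")
      case True
      \<comment> \<open>The lowest coefficient is zero: one common factor \<open>M\<close> cancels,
        and the remaining coefficients fall under the induction hypothesis.\<close>
      have "M * (M * ?P) = 0\<^sub>m n n"
      proof (rule eq_matI)
        fix i j assume "i < dim_row (0\<^sub>m n n)" "j < dim_col (0\<^sub>m n n)"
        then show "(M * (M * ?P)) $$ (i, j) = 0\<^sub>m n n $$ (i, j)"
          using arg_cong[OF eq, of "\<lambda>A. A $$ (i, j)"] True M P by simp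
      qed (use M P in auto)
      then have "M * ?P = 0\<^sub>m n n"
        by (rule symmetric_mult_cancel[OF M P])
      then show ?thesis using Cons True by auto
    next
      case False
      have "M * (M * (- (1 / c) \<cdot>\<^sub>m ?P)) = - (1 / c) \<cdot>\<^sub>m (M * (M * ?P))"
        using M P by (simp add: mult_smult_distrib[of _ n n _ n])
      also have "\<dots> = M"
      proof (rule eq_matI)
        fix i j assume "i < dim_row M" "j < dim_col M"
        then show "(- (1 / c) \<cdot>\<^sub>m (M * (M * ?P))) $$ (i, j) = M $$ (i, j)"
          using arg_cong[OF eq, of "\<lambda>A. A $$ (i, j)"] False M P
          by (simp add: field_simps del: index_mult_mat(1))
      qed (use M P in auto)
      finally show ?thesis by blast
    qed
  qed simp
  obtain cs where cs: "\<exists>c\<in>set cs. c \<noteq> 0" "poly_mat M cs = 0\<^sub>m n n"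
    using annihilating_poly_mat[OF M(1)] by blast
  have "M * poly_mat M cs = 0\<^sub>m n n"
    using M(1) by (simp add: cs(2))
  from step[OF this cs(1)] obtain ds d where eq: "M * (M * (d \<cdot>\<^sub>m poly_mat M ds)) = M"
    by (elim exE)
  have P: "poly_mat M ds \<in> carrier_mat n n" by (rule poly_mat_carrier[OF M(1)])
  have "transpose_mat (d \<cdot>\<^sub>m poly_mat M ds) = d \<cdot>\<^sub>m transpose_mat (poly_mat M ds)"
    by (rule eq_matI) auto
  then have "transpose_mat (d \<cdot>\<^sub>m poly_mat M ds) = d \<cdot>\<^sub>m poly_mat M ds"
    by (simp add: poly_mat_symmetric[OF M])
  moreover have "(d \<cdot>\<^sub>m poly_mat M ds) * M = M * (d \<cdot>\<^sub>m poly_mat M ds)"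
    using M P poly_mat_commute[OF M(1), of ds]
    by (simp add: mult_smult_assoc_mat[of _ n n _ n] mult_smult_distrib[of _ n n _ n])
  ultimately show thesis
    by (intro that[OF _ _ _ eq]) (simp add: P)
qed

text \<open>\<open>A * X\<close> and \<open>A * Y\<close> are orthogonal projections with the same
  range and hence equal; similarly \<open>X * A = Y * A\<close>. Then
  \<open>X = X * A * X = X * A * Y = Y * A * Y = Y\<close>.\<close>

lemma is_pinv_unique:
  assumes "is_pinv A X" "is_pinv A Y"
  shows "X = Y"
proof -
  define r c where "r = dim_row A" and "c = dim_col A"
  have A: "A \<in> carrier_mat r c" by (simp add: r_def c_def)
  have X: "X \<in> carrier_mat c r" and Y: "Y \<in> carrier_mat c r"
    using assms by (auto simp: is_pinv_def r_def c_def)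
  have x: "A * X * A = A" "X * A * X = X" "transpose_mat (A * X) = A * X" "transpose_mat (X * A) = X * A"
    and y: "A * Y * A = A" "Y * A * Y = Y" "transpose_mat (A * Y) = A * Y" "transpose_mat (Y * A) = Y * A"
    using assms by (auto simp: is_pinv_def)
  have "A * X = (A * Y * A) * X" by (simp add: y)
  also have "\<dots> = (A * Y) * (A * X)" using A X Y by (intro assoc_mult_mat[of _ r r _ c _ r]) auto
  also have "\<dots> = transpose_mat (A * Y) * transpose_mat (A * X)" by (simp add: x y)
  also have "\<dots> = transpose_mat ((A * X) * (A * Y))"
    by (rule transpose_mult[symmetric, of _ r r _ r]) (use A X Y in auto)
  also have "(A * X) * (A * Y) = A * X * A * Y"
    by (rule assoc_mult_mat[symmetric, of _ r r _ c _ r]) (use A X Y in auto)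
  finally have AX: "A * X = A * Y" by (simp add: x y)
  have "X * A = X * (A * Y * A)" by (simp add: y)
  also have "\<dots> = (X * A) * (Y * A)"
    using A X Y by (simp add: assoc_mult_mat[of _ c r _ c _ c] assoc_mult_mat[of _ r c _ r _ c])
  also have "\<dots> = transpose_mat (X * A) * transpose_mat (Y * A)" by (simp add: x y)
  also have "\<dots> = transpose_mat ((Y * A) * (X * A))"
    by (rule transpose_mult[symmetric, of _ c c _ c]) (use A X Y in auto)
  also have "(Y * A) * (X * A) = Y * (A * X * A)"
    using A X Y by (simp add: assoc_mult_mat[of _ c r _ c _ c] assoc_mult_mat[of _ r c _ r _ c])
  finally have XA: "X * A = Y * A" by (simp add: x y)
  have "X = X * (A * X)" using x(2) A X by (simp add: assoc_mult_mat[of _ c r _ c _ r])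
  also have "\<dots> = (X * A) * Y" using A X Y by (simp add: AX assoc_mult_mat[of _ c r _ c _ r])
  also have "\<dots> = Y" by (simp add: XA y)
  finally show ?thesis .
qed

lemma pinv_symmetric_matrix:
  fixes M :: "real mat"
  assumes M: "M \<in> carrier_mat n n" "transpose_mat M = M"
  shows "pinv M \<in> carrier_mat n n" "transpose_mat (pinv M) = pinv M"
    "M * pinv M * M = M" "pinv M * M * pinv M = pinv M"
    "transpose_mat (pinv M * M) = pinv M * M"
proof -
  obtain R where R: "R \<in> carrier_mat n n" "transpose_mat R = R" "R * M = M * R" "M * (M * R) = M"
    using symmetric_generalized_inverse[OF M] .
  \<comment> \<open>\<open>R\<close> satisfies \<open>M * R * M = M\<close> but perhaps not
    \<open>R * M * R = R\<close>; placing \<open>M\<close> between two copies of \<open>R\<close>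
    secures both equations.\<close>
  define X where "X = R * (M * R)"
  have X: "X \<in> carrier_mat n n" using M R by (simp add: X_def)
  have assoc: "A * B * C = A * (B * C)"
    if "A \<in> carrier_mat n n" "B \<in> carrier_mat n n" "C \<in> carrier_mat n n" for A B C :: "real mat"
    using that by (rule assoc_mult_mat)
  have MRM: "M * R * M = M" using R M by (simp add: assoc)
  have "M * X = M * R * (M * R)"
    unfolding X_def by (rule assoc[symmetric]) (use M R in auto)
  also have "\<dots> = M * R * M * R"
    by (rule assoc[symmetric]) (use M R in auto)
  finally have MX: "M * X = M * R" by (simp add: MRM)
  have "X * M = R * (M * R * M)" using M R by (simp add: X_def assoc)
  then have XM: "X * M = M * R" by (simp add: MRM R)
  have XMX: "X * M * X = X"
  proof -
    have "X * M * X = M * R * (R * (M * R))" unfolding XM by (simp only: X_def)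
    also have "\<dots> = R * M * (R * (M * R))" by (simp add: R(3))
    also have "\<dots> = R * (M * R * M * R)" using M R(1) by (simp add: assoc)
    also have "\<dots> = X" by (simp add: MRM X_def)
    finally show ?thesis .
  qed
  have symMR: "transpose_mat (M * R) = M * R"
    using M R by (simp add: transpose_mult[of _ n n])
  have "M * X * M = M" by (simp only: MX MRM)
  moreover have "transpose_mat (M * X) = M * X" "transpose_mat (X * M) = X * M"
    by (simp_all only: MX XM symMR)
  ultimately have pX: "is_pinv M X"
    unfolding is_pinv_def using M(1) X XMX by blast
  then have "pinv M = X"
    unfolding pinv_def using is_pinv_unique by (intro the_equality) auto
  moreover have "transpose_mat X = X"
  proof -
    have "transpose_mat X = transpose_mat (M * R) * transpose_mat R"
      unfolding X_def by (rule transpose_mult[of _ n n _ n]) (use M R in auto)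
    also have "\<dots> = R * M * R" by (simp only: symMR R(2,3))
    also have "\<dots> = X" unfolding X_def by (rule assoc) (use M R in auto)
    finally show ?thesis .
  qed
  ultimately show "pinv M \<in> carrier_mat n n" "transpose_mat (pinv M) = pinv M"
    "M * pinv M * M = M" "pinv M * M * pinv M = pinv M"
    "transpose_mat (pinv M * M) = pinv M * M"
    using X pX by (simp_all add: is_pinv_def)
qed

subsection \<open>Leverage scores\<close>

lemma gram_carrier: "gram n m a w \<in> carrier_mat n n"
  by (simp add: gram_def)

lemma gram_symmetric: "transpose_mat (gram n m a w) = gram n m a w"
  by (rule eq_matI) (auto simp: gram_def mult_ac intro!: sum.cong)

lemma gram_bilinear:
  assumes a: "\<And>i. i < m \<Longrightarrow> a i \<in> carrier_vec n" and x: "x \<in> carrier_vec n" and y: "y \<in> carrier_vec n"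
  shows "x \<bullet> (gram n m a w *\<^sub>v y) = (\<Sum>i<m. w i * (a i \<bullet> x) * (a i \<bullet> y))"
proof -
  have prod: "a i \<bullet> z = (\<Sum>j<n. a i $ j * z $ j)" if "z \<in> carrier_vec n" for i z
    using that by (simp add: scalar_prod_def atLeast0LessThan)
  have "x \<bullet> (gram n m a w *\<^sub>v y)
      = (\<Sum>j<n. x $ j * (\<Sum>k<n. (\<Sum>i<m. w i * (a i $ j) * (a i $ k)) * y $ k))"
    using x y by (simp add: scalar_prod_def gram_def atLeast0LessThan)
  also have "\<dots> = (\<Sum>j<n. \<Sum>k<n. \<Sum>i<m. w i * (a i $ j * x $ j) * (a i $ k * y $ k))"
    unfolding sum_distrib_left sum_distrib_right
    by (intro sum.cong refl) (simp only: mult_ac)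
  also have "\<dots> = (\<Sum>j<n. \<Sum>i<m. \<Sum>k<n. w i * (a i $ j * x $ j) * (a i $ k * y $ k))"
    by (intro sum.cong refl sum.swap)
  also have "\<dots> = (\<Sum>i<m. \<Sum>j<n. \<Sum>k<n. w i * (a i $ j * x $ j) * (a i $ k * y $ k))"
    by (rule sum.swap)
  also have "\<dots> = (\<Sum>i<m. w i * (a i \<bullet> x) * (a i \<bullet> y))"
    unfolding prod[OF x] prod[OF y]
    unfolding sum_product mult.assoc by (simp only: sum_distrib_left)
  finally show ?thesis .
qed

lemma psd_gram_iff:
  assumes "\<And>i. i < m \<Longrightarrow> a i \<in> carrier_vec n"
  shows "psd (gram n m a w) \<longleftrightarrow> (\<forall>v\<in>carrier_vec n. 0 \<le> (\<Sum>i<m. w i * (a i \<bullet> v)\<^sup>2))"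
proof -
  have "v \<bullet> (gram n m a w *\<^sub>v v) = (\<Sum>i<m. w i * (a i \<bullet> v)\<^sup>2)" if "v \<in> carrier_vec n" for v
    using gram_bilinear[of m a n v v w, OF assms that that] by (simp add: power2_eq_square mult.assoc)
  moreover have "dim_row (gram n m a w) = n" "dim_col (gram n m a w) = n"
    by (simp_all add: gram_def)
  ultimately show ?thesis
    unfolding psd_def gram_symmetric by simp
qed

lemma loewner_gram_iff:
  assumes "\<And>i. i < m \<Longrightarrow> a i \<in> carrier_vec n"
  shows "loewner_le (c \<cdot>\<^sub>m gram n m a (\<lambda>_. 1)) (gram n m a w) \<longleftrightarrow>
      (\<forall>v\<in>carrier_vec n. c * (\<Sum>i<m. (a i \<bullet> v)\<^sup>2) \<le> (\<Sum>i<m. w i * (a i \<bullet> v)\<^sup>2))"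
    and "loewner_le (gram n m a w) (c \<cdot>\<^sub>m gram n m a (\<lambda>_. 1)) \<longleftrightarrow>
      (\<forall>v\<in>carrier_vec n. (\<Sum>i<m. w i * (a i \<bullet> v)\<^sup>2) \<le> c * (\<Sum>i<m. (a i \<bullet> v)\<^sup>2))"
proof -
  have "gram n m a w - c \<cdot>\<^sub>m gram n m a (\<lambda>_. 1) = gram n m a (\<lambda>i. w i - c)"
    by (rule eq_matI) (auto simp: gram_def sum_distrib_left sum_subtractf[symmetric] algebra_simps)
  moreover have "c \<cdot>\<^sub>m gram n m a (\<lambda>_. 1) - gram n m a w = gram n m a (\<lambda>i. c - w i)"
    by (rule eq_matI) (auto simp: gram_def sum_distrib_left sum_subtractf[symmetric] algebra_simps)
  ultimately show "loewner_le (c \<cdot>\<^sub>m gram n m a (\<lambda>_. 1)) (gram n m a w) \<longleftrightarrow>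
      (\<forall>v\<in>carrier_vec n. c * (\<Sum>i<m. (a i \<bullet> v)\<^sup>2) \<le> (\<Sum>i<m. w i * (a i \<bullet> v)\<^sup>2))"
    and "loewner_le (gram n m a w) (c \<cdot>\<^sub>m gram n m a (\<lambda>_. 1)) \<longleftrightarrow>
      (\<forall>v\<in>carrier_vec n. (\<Sum>i<m. w i * (a i \<bullet> v)\<^sup>2) \<le> c * (\<Sum>i<m. (a i \<bullet> v)\<^sup>2))"
    by (simp_all add: loewner_le_def psd_gram_iff[OF assms] left_diff_distrib sum_subtractf sum_distrib_left)
qed

definition violated :: "nat \<Rightarrow> nat \<Rightarrow> (nat \<Rightarrow> real vec) \<Rightarrow> real \<Rightarrow> (nat \<Rightarrow> real) \<Rightarrow> bool" where
  "violated n m a \<epsilon> w \<longleftrightarrow> \<not> (loewner_le ((1 - \<epsilon>) \<cdot>\<^sub>m gram n m a (\<lambda>_. 1)) (gram n m a w) \<and>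
     loewner_le (gram n m a w) ((1 + \<epsilon>) \<cdot>\<^sub>m gram n m a (\<lambda>_. 1)))"

lemma violated_gram_iff:
  assumes "\<And>i. i < m \<Longrightarrow> a i \<in> carrier_vec n"
  shows "violated n m a \<epsilon> w \<longleftrightarrow> (\<exists>v\<in>carrier_vec n.
    (\<Sum>i<m. w i * (a i \<bullet> v)\<^sup>2) < (1 - \<epsilon>) * (\<Sum>i<m. (a i \<bullet> v)\<^sup>2) \<or>
    (1 + \<epsilon>) * (\<Sum>i<m. (a i \<bullet> v)\<^sup>2) < (\<Sum>i<m. w i * (a i \<bullet> v)\<^sup>2))"
  by (auto simp: violated_def loewner_gram_iff assms not_le)

text \<open>A diagonal entry \<open>x\<close> is the squared norm of its column, which contains
  \<open>x\<close> itself; so \<open>x ^ 2 \<le> x\<close> and \<open>x \<le> 1\<close>.\<close>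

lemma trace_symmetric_projection_le:
  fixes Q :: "real mat"
  assumes Q: "Q \<in> carrier_mat n n" "transpose_mat Q = Q" "Q * Q = Q"
  shows "(\<Sum>j<n. Q $$ (j, j)) \<le> real n"
proof -
  have "Q $$ (j, j) \<le> 1" if j: "j < n" for j
  proof -
    have "Q $$ (j, j) = (Q * Q) $$ (j, j)" by (simp add: Q(3))
    also have "\<dots> = (\<Sum>k<n. Q $$ (j, k) * Q $$ (k, j))"
      using Q(1) j by (simp add: scalar_prod_def atLeast0LessThan)
    also have "\<dots> = (\<Sum>k<n. (Q $$ (k, j))\<^sup>2)"
    proof (intro sum.cong refl)
      fix k assume "k \<in> {..<n}"
      then have "transpose_mat Q $$ (j, k) = Q $$ (k, j)" using Q(1) j by simp
      then show "Q $$ (j, k) * Q $$ (k, j) = (Q $$ (k, j))\<^sup>2"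
        by (simp add: Q(2) power2_eq_square)
    qed
    finally have eq: "Q $$ (j, j) = (\<Sum>k<n. (Q $$ (k, j))\<^sup>2)" .
    have "(Q $$ (j, j))\<^sup>2 \<le> Q $$ (j, j)"
      by (subst (2) eq) (rule member_le_sum[where f="\<lambda>k. (Q $$ (k, j))\<^sup>2"], use j in auto)
    then show ?thesis
      using mult_strict_right_mono[of 1 "Q $$ (j, j)" "Q $$ (j, j)"]
      by (cases "Q $$ (j, j) \<le> 1") (auto simp: power2_eq_square)
  qed
  then show ?thesis
    using sum_mono[of "{..<n}" "\<lambda>j. Q $$ (j, j)" "\<lambda>_. 1"] by simp
qed

section \<open>The leverage kernel\<close>

locale vector_family =
  fixes n m :: nat and a :: "nat \<Rightarrow> real vec"
  assumes a: "\<And>i. i < m \<Longrightarrow> a i \<in> carrier_vec n"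
begin

abbreviation "M \<equiv> gram n m a (\<lambda>_. 1)"

text \<open>The orthogonal projection onto the column space of the matrix with rows
  \<open>a i\<close>; its diagonal holds the leverage scores by which the legality of a move is
  decided.\<close>

definition lev :: "nat \<Rightarrow> nat \<Rightarrow> real" where
  "lev i j = a i \<bullet> (pinv M *\<^sub>v a j)"

lemmas pinv_facts = pinv_symmetric_matrix[OF gram_carrier[of n m a "\<lambda>_. 1"] gram_symmetric]

lemma pinv_swap:
  assumes "x \<in> carrier_vec n" "y \<in> carrier_vec n"
  shows "x \<bullet> (pinv M *\<^sub>v y) = (pinv M *\<^sub>v x) \<bullet> y"
  using transpose_vec_mult_scalar[OF pinv_facts(1) assms(2,1)] by (simp add: pinv_facts(2))

lemma pinv_carrier: "x \<in> carrier_vec n \<Longrightarrow> pinv M *\<^sub>v x \<in> carrier_vec n"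
  using pinv_facts(1) by simp

lemma lev_alt:
  assumes "i < m" "j < m"
  shows "lev i j = a j \<bullet> (pinv M *\<^sub>v a i)"
  unfolding lev_def pinv_swap[OF a[OF assms(1)] a[OF assms(2)]]
  by (rule comm_scalar_prod[of _ n]) (use assms a pinv_carrier in auto)

lemma gram_mult_carrier: "x \<in> carrier_vec n \<Longrightarrow> gram n m a w *\<^sub>v x \<in> carrier_vec n"
  using gram_carrier[of n m a w] by simp

lemma lev_idem:
  assumes i: "i < m" and k: "k < m"
  shows "(\<Sum>j<m. lev i j * lev j k) = lev i k"
proof -
  have "(\<Sum>j<m. lev i j * lev j k) = (\<Sum>j<m. 1 * (a j \<bullet> (pinv M *\<^sub>v a i)) * (a j \<bullet> (pinv M *\<^sub>v a k)))"
    using i by (intro sum.cong refl) (simp add: lev_alt[of i] lev_def[of _ k])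
  also have "\<dots> = (pinv M *\<^sub>v a i) \<bullet> (M *\<^sub>v (pinv M *\<^sub>v a k))"
    by (rule gram_bilinear[symmetric]) (use a i k pinv_carrier in auto)
  also have "\<dots> = a i \<bullet> (pinv M *\<^sub>v (M *\<^sub>v (pinv M *\<^sub>v a k)))"
    by (rule pinv_swap[symmetric]) (use a i k pinv_carrier gram_mult_carrier in auto)
  also have "pinv M *\<^sub>v (M *\<^sub>v (pinv M *\<^sub>v a k)) = (pinv M * M * pinv M) *\<^sub>v a k"
    using pinv_facts(1) gram_carrier[of n m a "\<lambda>_. 1"] a[OF k]
    by (simp add: assoc_mult_mat_vec[of _ n n _ n])
  finally show ?thesis by (simp add: lev_def pinv_facts(4))
qed

text \<open>This places the vector of all \<open>a l \<bullet> v\<close> in the range of the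
  projection. The error \<open>z\<close> lies in the kernel of \<open>M\<close>, and its quadratic
  form under \<open>M\<close> is a sum of squares, so \<open>z\<close> is orthogonal to every
  \<open>a j\<close>.\<close>

lemma lev_fixes_coordinates:
  assumes j: "j < m" and v: "v \<in> carrier_vec n"
  shows "(\<Sum>l<m. lev j l * (a l \<bullet> v)) = a j \<bullet> v"
proof -
  define z where "z = pinv M *\<^sub>v (M *\<^sub>v v) - v"
  have z: "z \<in> carrier_vec n"
    using v pinv_carrier gram_mult_carrier by (simp add: z_def)
  have "M *\<^sub>v z = M *\<^sub>v (pinv M *\<^sub>v (M *\<^sub>v v)) - M *\<^sub>v v"
    unfolding z_def using gram_carrier[of n m a "\<lambda>_. 1"] v pinv_carrier gram_mult_carrier
    by (intro mult_minus_distrib_mat_vec[of _ n n]) auto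
  also have "M *\<^sub>v (pinv M *\<^sub>v (M *\<^sub>v v)) = (M * pinv M * M) *\<^sub>v v"
    using pinv_facts(1) gram_carrier[of n m a "\<lambda>_. 1"] v
    by (simp add: assoc_mult_mat_vec[of _ n n _ n])
  finally have "M *\<^sub>v z = 0\<^sub>v n"
    using v gram_mult_carrier by (simp add: pinv_facts(3))
  then have "(\<Sum>i<m. 1 * (a i \<bullet> z) * (a i \<bullet> z)) = 0"
    using gram_bilinear[of m a n z z "\<lambda>_. 1", OF a z z] z by simp
  then have "(a j \<bullet> z) * (a j \<bullet> z) = 0"
    by (subst (asm) sum_nonneg_eq_0_iff) (use j in auto)
  then have 0: "a j \<bullet> (pinv M *\<^sub>v (M *\<^sub>v v)) = a j \<bullet> v"
    using scalar_prod_minus_distrib[of "a j" n "pinv M *\<^sub>v (M *\<^sub>v v)" v] a[OF j] v pinv_carrier gram_mult_carrier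
    by (simp add: z_def)
  have "(\<Sum>l<m. lev j l * (a l \<bullet> v)) = (\<Sum>l<m. 1 * (a l \<bullet> (pinv M *\<^sub>v a j)) * (a l \<bullet> v))"
    using j by (intro sum.cong refl) (simp add: lev_alt[of j])
  also have "\<dots> = (pinv M *\<^sub>v a j) \<bullet> (M *\<^sub>v v)"
    by (rule gram_bilinear[symmetric]) (use a j v pinv_carrier in auto)
  also have "\<dots> = a j \<bullet> (pinv M *\<^sub>v (M *\<^sub>v v))"
    by (rule pinv_swap[symmetric]) (use a j v gram_mult_carrier in auto)
  finally show ?thesis by (simp add: 0)
qed

text \<open>Cyclicity turns the sum into the trace of \<open>pinv M * M\<close>, a symmetric
  projection of size \<open>n\<close>; so the bound is free of \<open>m\<close>.\<close>

lemma sum_lev_le: "(\<Sum>i<m. lev i i) \<le> real n"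
proof -
  let ?P = "pinv M"
  have P: "?P \<in> carrier_mat n n" and M: "M \<in> carrier_mat n n"
    by (rule pinv_facts(1), rule gram_carrier)
  have "(\<Sum>i<m. lev i i) = (\<Sum>i<m. \<Sum>j<n. \<Sum>k<n. ?P $$ (j, k) * (a i $ k * a i $ j))"
  proof (intro sum.cong refl)
    fix i assume "i \<in> {..<m}"
    then have "a i \<in> carrier_vec n" using a by simp
    then show "lev i i = (\<Sum>j<n. \<Sum>k<n. ?P $$ (j, k) * (a i $ k * a i $ j))"
      using P by (simp add: lev_def scalar_prod_def atLeast0LessThan sum_distrib_left mult_ac)
  qed
  also have "\<dots> = (\<Sum>j<n. \<Sum>i<m. \<Sum>k<n. ?P $$ (j, k) * (a i $ k * a i $ j))"
    by (rule sum.swap)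
  also have "\<dots> = (\<Sum>j<n. \<Sum>k<n. \<Sum>i<m. ?P $$ (j, k) * (a i $ k * a i $ j))"
    by (intro sum.cong refl sum.swap)
  also have "\<dots> = (\<Sum>j<n. (?P * M) $$ (j, j))"
    using P by (intro sum.cong refl) (simp add: scalar_prod_def gram_def atLeast0LessThan sum_distrib_left)
  also have "\<dots> \<le> real n"
  proof (rule trace_symmetric_projection_le)
    have "?P * M * (?P * M) = ?P * M * ?P * M"
      by (rule assoc_mult_mat[symmetric, of _ n n _ n _ n]) (use P M in auto)
    then show "?P * M * (?P * M) = ?P * M" by (simp only: pinv_facts(4))
  qed (use P M pinv_facts(5) in auto)
  finally show ?thesis .
qed

end

sublocale vector_family \<subseteq> projection_kernel m lev
proof
  show "lev i j = lev j i" if "i < m" "j < m" for i j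
    by (subst lev_alt[OF that]) (rule lev_def[symmetric])
qed (rule lev_idem)

subsection \<open>Histories and measurability\<close>

text \<open>Play resumed from an arbitrary history with a fresh stream, so that an induction can
  split off the first coin.\<close>

primrec extend_history :: "strategy \<Rightarrow> bool list \<Rightarrow> real stream \<Rightarrow> nat \<Rightarrow> bool list" where
  "extend_history s h \<omega> 0 = h"
| "extend_history s h \<omega> (Suc t) =
     (\<omega> !! t \<le> snd (s (extend_history s h \<omega> t))) # extend_history s h \<omega> t"

lemma history_eq_extend: "history s \<omega> t = extend_history s [] \<omega> t"
  by (induction t) simp_all

lemma extend_history_Stream:
  "extend_history s h (x ## \<omega>) (Suc t) = extend_history s ((x \<le> snd (s h)) # h) \<omega> t"
  by (induction t) simp_all

abbreviation unit_uniform :: "real measure" where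
  "unit_uniform \<equiv> uniform_measure lborel {0..1}"

lemma prob_space_unit_uniform: "prob_space unit_uniform"
  by (rule prob_space_uniform_measure) simp_all

lemma prob_space_coins: "prob_space coins"
  unfolding coins_def by (rule prob_space.prob_space_stream_space[OF prob_space_unit_uniform])

lemma measurable_coin [measurable]: "(\<lambda>\<omega>. \<omega> !! t) \<in> borel_measurable coins"
  using measurable_snth[of t unit_uniform] unfolding coins_def by simp

lemma measurable_extend_history [measurable]:
  "(\<lambda>\<omega>. extend_history s h \<omega> t) \<in> coins \<rightarrow>\<^sub>M count_space UNIV"
proof (induction t)
  case (Suc t)
  then have [measurable]: "(\<lambda>\<omega>. extend_history s h \<omega> t) \<in> coins \<rightarrow>\<^sub>M count_space UNIV" by simp
  have "(\<lambda>\<omega>. (\<omega> !! t \<le> snd (s h'')) # h'') \<in> coins \<rightarrow>\<^sub>M count_space UNIV" for h''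
    by measurable
  from measurable_compose_countable[where f="\<lambda>h'' \<omega>. (\<omega> !! t \<le> snd (s h'')) # h''", OF this, OF \<open>(\<lambda>\<omega>. extend_history s h \<omega> t) \<in> _\<close>]
  show ?case by simp
qed simp

lemma measure_unit_uniform_atMost:
  assumes "0 \<le> p" "p \<le> 1"
  shows "measure unit_uniform {..p} = p"
proof -
  have "{0..1} \<inter> {..p} = {0..p}" using assms by auto
  then show ?thesis using assms by simp
qed

text \<open>At a bad \<open>h\<close> the bound is at least one; otherwise the first coin is
  integrated out. The success probability is the measure \<open>q\<close>, since the
  \<open>p\<close> of a move that is not legal may lie outside \<open>[0, 1]\<close>. Here
  \<open>\<theta>\<close> is the threshold.\<close>

lemma ville_finite_horizon:
  fixes \<Phi> :: "bool list \<Rightarrow> real" and s :: strategy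
  assumes nonneg: "\<And>h. 0 \<le> \<Phi> h" and \<theta>: "0 < \<theta>" and bad: "\<And>h. bad h \<Longrightarrow> \<theta> \<le> \<Phi> h"
    and super: "\<And>h. let q = measure unit_uniform {..snd (s h)} in
      q * \<Phi> (True # h) + (1 - q) * \<Phi> (False # h) \<le> \<Phi> h"
  shows "measure coins {\<omega> \<in> space coins. \<exists>t\<le>T. bad (extend_history s h \<omega> t)} \<le> \<Phi> h / \<theta>"
proof (induction T arbitrary: h)
  case 0
  interpret coins: prob_space coins by (rule prob_space_coins)
  show ?case
  proof (cases "bad h")
    case True
    have "measure coins {\<omega> \<in> space coins. \<exists>t\<le>0. bad (extend_history s h \<omega> t)} \<le> 1"
      by (rule coins.prob_le_1)
    also have "\<dots> \<le> \<Phi> h / \<theta>" using bad[OF True] \<theta> by simp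
    finally show ?thesis .
  next
    case False
    have "{\<omega> \<in> space coins. \<exists>t\<le>0. bad (extend_history s h \<omega> t)} = {}"
      using False by simp
    moreover have "0 \<le> \<Phi> h / \<theta>" using nonneg[of h] \<theta> by simp
    ultimately show ?thesis by (simp only: measure_empty)
  qed
next
  case (Suc T)
  interpret coins: prob_space coins by (rule prob_space_coins)
  interpret U: prob_space unit_uniform by (rule prob_space_unit_uniform)
  let ?E = "\<lambda>T h. {\<omega> \<in> space coins. \<exists>t\<le>T. bad (extend_history s h \<omega> t)}"
  have E[measurable]: "?E T h \<in> sets coins" for T h by measurable
  show ?case
  proof (cases "bad h")
    case True
    have "measure coins (?E (Suc T) h) \<le> 1" by simp
    also have "\<dots> \<le> \<Phi> h / \<theta>" using bad[OF True] \<theta> by simp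
    finally show ?thesis .
  next
    case False
    let ?p = "snd (s h)"
    let ?q = "measure unit_uniform {..?p}"
    \<comment> \<open>As \<open>h\<close> is not bad, consuming the first coin turns horizon
      \<open>Suc T\<close> from \<open>h\<close> into horizon \<open>T\<close> from the longer
      history.\<close>
    have shift: "(x ## \<omega> \<in> ?E (Suc T) h) = (\<omega> \<in> ?E T ((x \<le> ?p) # h))"
      if "x ## \<omega> \<in> space coins" "\<omega> \<in> space coins" for x \<omega>
    proof -
      have "(\<exists>t\<le>Suc T. bad (extend_history s h (x ## \<omega>) t))
          = (\<exists>t\<le>T. bad (extend_history s h (x ## \<omega>) (Suc t)))"
        using False by (metis Suc_le_mono extend_history.simps(1) not0_implies_Suc)
      then show ?thesis
        unfolding extend_history_Stream using that by simp
    qed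
    have stream: "x ## \<omega> \<in> space coins" if "\<omega> \<in> space coins" for x \<omega>
      using that by (simp add: coins_def space_stream_space)
    have "emeasure coins (?E (Suc T) h)
        = (\<integral>\<^sup>+x. emeasure coins {\<omega> \<in> space coins. x ## \<omega> \<in> ?E (Suc T) h} \<partial>unit_uniform)"
      by (rule U.emeasure_stream_space[folded coins_def]) (rule E)
    also have "\<dots> = (\<integral>\<^sup>+x. emeasure coins (?E T ((x \<le> ?p) # h)) \<partial>unit_uniform)"
    proof (intro nn_integral_cong arg_cong[where f="emeasure coins"])
      show "{\<omega> \<in> space coins. x ## \<omega> \<in> ?E (Suc T) h} = ?E T ((x \<le> ?p) # h)" for x
        using shift stream by auto
    qed
    also have "\<dots> \<le> (\<integral>\<^sup>+x. ennreal (\<Phi> (True # h) / \<theta>) * indicator {..?p} x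
        + ennreal (\<Phi> (False # h) / \<theta>) * indicator {?p<..} x \<partial>unit_uniform)"
      using Suc.IH[of "True # h"] Suc.IH[of "False # h"]
      by (intro nn_integral_mono)
        (auto simp: coins.emeasure_eq_measure nonneg \<theta> less_imp_le split: split_indicator intro!: ennreal_leI)
    also have "\<dots> = ennreal (\<Phi> (True # h) / \<theta>) * emeasure unit_uniform {..?p}
        + ennreal (\<Phi> (False # h) / \<theta>) * emeasure unit_uniform {?p<..}"
      by (subst nn_integral_add) (auto simp: nn_integral_cmult_indicator)
    also have "emeasure unit_uniform {?p<..} = ennreal (1 - ?q)"
    proof -
      have "{?p<..} = space unit_uniform - {..?p}" by auto
      then show ?thesis using U.prob_compl[of "{..?p}"] by (simp add: U.emeasure_eq_measure)
    qed
    also have "ennreal (\<Phi> (True # h) / \<theta>) * emeasure unit_uniform {..?p}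
        + ennreal (\<Phi> (False # h) / \<theta>) * ennreal (1 - ?q)
        = ennreal ((?q * \<Phi> (True # h) + (1 - ?q) * \<Phi> (False # h)) / \<theta>)"
      using nonneg \<theta>
      by (simp add: U.emeasure_eq_measure ennreal_mult[symmetric] ennreal_plus[symmetric] add_divide_distrib
          mult.commute del: ennreal_plus)
    also have "\<dots> \<le> ennreal (\<Phi> h / \<theta>)"
      using super[of h] \<theta> by (intro ennreal_leI divide_right_mono) (auto simp: Let_def)
    finally show ?thesis
      using nonneg[of h] \<theta> by (simp add: coins.emeasure_eq_measure ennreal_le_iff)
  qed
qed

section \<open>Measurability of the winning event\<close>

lemma adversary_wins_iff:
  "adversary_wins n m a \<alpha> \<epsilon> s \<omega> \<longleftrightarrow> (\<exists>t. violated n m a \<epsilon> (weights n m a \<alpha> s (history s \<omega> t)))"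
  by (simp add: adversary_wins_def violated_def Let_def)

lemma measurable_weights:
  assumes \<sigma>: "\<And>h. (\<lambda>r. \<sigma> r h) \<in> R \<rightarrow>\<^sub>M (count_space UNIV \<Otimes>\<^sub>M borel)"
  shows "(\<lambda>r. weights n m a \<alpha> (\<sigma> r) h i) \<in> borel_measurable R"
proof (induction h arbitrary: i)
  case (Cons b h)
  define I where "I = (\<lambda>r. fst (\<sigma> r h))"
  define p where "p = (\<lambda>r. snd (\<sigma> r h))"
  define w where "w = (\<lambda>r. weights n m a \<alpha> (\<sigma> r) h)"
  define v where "v = (\<lambda>r. w r (I r))"
  define l where "l = (\<lambda>i. a i \<bullet> (pinv (gram n m a (\<lambda>_. 1)) *\<^sub>v a i))"
  have I [measurable]: "I \<in> R \<rightarrow>\<^sub>M count_space UNIV"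
    unfolding I_def by (rule measurable_compose[OF \<sigma> measurable_fst])
  have [measurable]: "p \<in> borel_measurable R"
    unfolding p_def by (rule measurable_compose[OF \<sigma> measurable_snd])
  have w [measurable]: "(\<lambda>r. w r i) \<in> borel_measurable R" for i
    unfolding w_def by (rule Cons.IH)
  \<comment> \<open>The index depends on the seed too, but takes only countably many values, so
    evaluation there stays measurable.\<close>
  have [measurable]: "v \<in> borel_measurable R"
    unfolding v_def using measurable_compose_countable[where f="\<lambda>i r. w r i", OF w I] .
  have [measurable]: "(\<lambda>r. l (I r)) \<in> borel_measurable R"
    by (rule measurable_compose[OF I]) simp
  have eq: "weights n m a \<alpha> (\<sigma> r) (b # h) i =
      (if I r < m \<and> 0 < p r \<and> p r \<le> 1 \<and> v r \<noteq> 0 \<and> v r / p r * l (I r) \<le> 1 / \<alpha>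
       then (if i = I r then (if b then v r / p r else 0) else w r i) else w r i)" for r
    by (cases "\<sigma> r h")
      (simp add: legal_move_def make_move_def I_def p_def w_def v_def l_def Let_def)
  show ?case
    unfolding eq by measurable
qed simp

lemma measurable_history:
  assumes \<sigma>: "\<And>h. (\<lambda>r. \<sigma> r h) \<in> R \<rightarrow>\<^sub>M (count_space UNIV \<Otimes>\<^sub>M borel)"
  shows "(\<lambda>x. history (\<sigma> (fst x)) (snd x) t) \<in> R \<Otimes>\<^sub>M coins \<rightarrow>\<^sub>M count_space UNIV"
proof (induction t)
  case (Suc t)
  have [measurable]: "(\<lambda>r. snd (\<sigma> r h)) \<in> borel_measurable R" for h
    by (rule measurable_compose[OF \<sigma> measurable_snd])
  have "(\<lambda>x. (snd x !! t \<le> snd (\<sigma> (fst x) h)) # h) \<in> R \<Otimes>\<^sub>M coins \<rightarrow>\<^sub>M count_space UNIV" for h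
    by measurable
  from measurable_compose_countable[where f="\<lambda>h x. (snd x !! t \<le> snd (\<sigma> (fst x) h)) # h", OF this Suc]
  show ?case by simp
qed simp

text \<open>The violation is an uncountable union over test vectors. Each member is open by
  continuity in \<open>w\<close>, so the union is open and hence Borel.\<close>

lemma open_violated:
  assumes a: "\<And>i. i < m \<Longrightarrow> a i \<in> carrier_vec n"
  shows "open {w. violated n m a \<epsilon> w}"
proof -
  have cont: "continuous_on UNIV (\<lambda>w::nat \<Rightarrow> real. \<Sum>i<m. w i * (a i \<bullet> v)\<^sup>2)" for v
    by (intro continuous_intros continuous_on_product_coordinates)
  have "{w. violated n m a \<epsilon> w} = (\<Union>v\<in>carrier_vec n.
      {w. (\<Sum>i<m. w i * (a i \<bullet> v)\<^sup>2) < (1 - \<epsilon>) * (\<Sum>i<m. (a i \<bullet> v)\<^sup>2)} \<union>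
      {w. (1 + \<epsilon>) * (\<Sum>i<m. (a i \<bullet> v)\<^sup>2) < (\<Sum>i<m. w i * (a i \<bullet> v)\<^sup>2)})"
    by (auto simp: violated_gram_iff a)
  then show ?thesis
    using cont by (auto intro!: open_UN open_Un open_Collect_less)
qed

lemma win_event_measurable:
  assumes a: "\<And>i. i < m \<Longrightarrow> a i \<in> carrier_vec n"
    and \<sigma>: "\<And>h. (\<lambda>r. \<sigma> r h) \<in> R \<rightarrow>\<^sub>M (count_space UNIV \<Otimes>\<^sub>M borel)"
  shows "win_event n m a \<alpha> \<epsilon> R \<sigma> \<in> sets (R \<Otimes>\<^sub>M coins)"
proof -
  have W: "(\<lambda>r. weights n m a \<alpha> (\<sigma> r) h) \<in> borel_measurable R" for h
    by (rule measurable_coordinatewise_then_product) (rule measurable_weights[OF \<sigma>])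
  have "Measurable.pred R (\<lambda>r. violated n m a \<epsilon> (weights n m a \<alpha> (\<sigma> r) h))" for h
    using measurable_sets[OF W borel_open[OF open_violated[of m a n \<epsilon>, OF a]], of h]
    by (simp add: pred_def vimage_def Int_def conj_commute)
  then have "Measurable.pred (R \<Otimes>\<^sub>M coins) (\<lambda>x. violated n m a \<epsilon> (weights n m a \<alpha> (\<sigma> (fst x)) h))" for h
    by (rule measurable_compose[OF measurable_fst])
  from measurable_compose_countable[where f="\<lambda>h x. violated n m a \<epsilon> (weights n m a \<alpha> (\<sigma> (fst x)) h)",
      OF this measurable_history[OF \<sigma>]]
  have "Measurable.pred (R \<Otimes>\<^sub>M coins)
      (\<lambda>x. violated n m a \<epsilon> (weights n m a \<alpha> (\<sigma> (fst x)) (history (\<sigma> (fst x)) (snd x) t)))" for t .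
  then have "Measurable.pred (R \<Otimes>\<^sub>M coins)
      (\<lambda>x. \<exists>t. violated n m a \<epsilon> (weights n m a \<alpha> (\<sigma> (fst x)) (history (\<sigma> (fst x)) (snd x) t)))"
    by measurable
  moreover have "win_event n m a \<alpha> \<epsilon> R \<sigma> = {x \<in> space (R \<Otimes>\<^sub>M coins).
      \<exists>t. violated n m a \<epsilon> (weights n m a \<alpha> (\<sigma> (fst x)) (history (\<sigma> (fst x)) (snd x) t))}"
    by (auto simp: win_event_def adversary_wins_iff)
  ultimately show ?thesis by (simp add: pred_def)
qed

subsection \<open>The winning probability\<close>

text \<open>Removes the truncation of the exponential series once a bound uniform in
  \<open>Q\<close> is available.\<close>

lemma mult_exp_le_of_partial_sums:
  fixes p x B :: real
  assumes "\<And>Q. p * (\<Sum>q<Suc Q. x ^ q / fact q) \<le> B"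
  shows "p * exp x \<le> B"
proof (rule LIMSEQ_le_const2)
  have "(\<lambda>n. x ^ n / fact n) sums exp x"
    using exp_converges[of x] by (simp add: divide_inverse mult.commute)
  then have "(\<lambda>Q. \<Sum>q<Suc Q. x ^ q / fact q) \<longlonglongrightarrow> exp x"
    unfolding sums_def by (rule LIMSEQ_Suc)
  then show "(\<lambda>Q. p * (\<Sum>q<Suc Q. x ^ q / fact q)) \<longlonglongrightarrow> p * exp x"
    by (intro tendsto_mult_left)
  show "\<exists>N. \<forall>Q\<ge>N. p * (\<Sum>q<Suc Q. x ^ q / fact q) \<le> B"
    using assms by blast
qed

section \<open>A fixed deterministic strategy\<close>

locale resparsification_game = vector_family +
  fixes \<alpha> \<epsilon> :: real and s :: strategy
  assumes alpha_pos: "0 < \<alpha>" and eps: "0 < \<epsilon>" "\<epsilon> < 1 / 2"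

sublocale resparsification_game \<subseteq> game_kernel m lev "1 / \<alpha>"
  by unfold_locales (simp add: alpha_pos)

context resparsification_game
begin

abbreviation wt :: "bool list \<Rightarrow> nat \<Rightarrow> real" where
  "wt \<equiv> weights n m a \<alpha> s"

lemma lev_nonneg: "i < m \<Longrightarrow> 0 \<le> lev i i"
  using diag_eq_sum_squares[of i] by (simp add: sum_nonneg)

lemma legal_move_iff: "legal_move n m a \<alpha> w (i, p) \<longleftrightarrow>
    i < m \<and> 0 < p \<and> p \<le> 1 \<and> w i \<noteq> 0 \<and> w i / p * lev i i \<le> 1 / \<alpha>"
  by (simp add: legal_move_def lev_def)

text \<open>A score above \<open>1 / \<alpha>\<close> breaks the legality bound already at weight
  one with \<open>p = 1\<close>, and smaller \<open>p\<close> is worse, so such an index is never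
  moved. At an active index, legality is the bound by \<open>cap\<close>.\<close>

lemma weights_invariant:
  "(\<forall>i. 0 \<le> wt h i) \<and> (\<forall>i\<in>set active. wt h i \<le> cap i) \<and> (\<forall>i<m. 1 / \<alpha> < lev i i \<longrightarrow> wt h i = 1)"
proof (induction h)
  case Nil
  then show ?case using cap_ge_1 by simp
next
  case (Cons b h)
  obtain i p where ip: "s h = (i, p)" by fastforce
  show ?case
  proof (cases "legal_move n m a \<alpha> (wt h) (i, p)")
    case True
    then have l: "i < m" "0 < p" "p \<le> 1" "wt h i / p * lev i i \<le> 1 / \<alpha>"
      by (simp_all add: legal_move_iff)
    have "wt h i / p \<le> cap i" if "i \<in> set active"
      using that l(4) unfolding cap_def set_active by (subst pos_le_divide_eq) simp_all
    moreover have "0 \<le> wt h i / p" using Cons l by simp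
    moreover have "\<not> 1 / \<alpha> < lev i i"
    proof
      assume big: "1 / \<alpha> < lev i i"
      then have "wt h i = 1" using Cons l by simp
      then have "1 * lev i i \<le> wt h i / p * lev i i"
        using l lev_nonneg[OF l(1)] by (intro mult_right_mono) simp_all
      then show False using l(4) big by simp
    qed
    ultimately show ?thesis
      using True Cons cap_pos by (auto simp: ip make_move_def Let_def less_imp_le)
  qed (use Cons in \<open>simp add: ip\<close>)
qed

text \<open>The weights as the potential sees them. Resetting inactive weights to one loses nothing:
  large scores are never moved, and where \<open>lev i i = 0\<close> every vector in
  \<open>fixed\<close> vanishes at \<open>i\<close>.\<close>

definition state :: "bool list \<Rightarrow> nat \<Rightarrow> real" where
  "state h = (\<lambda>i. if i \<in> set active then wt h i else 1)"

lemma state_feasible: "feasible (state h)"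
  using weights_invariant[of h] by (simp add: feasible_def state_def)

text \<open>A legal move at an active index preserves the mean potential; any other round leaves the
  state unchanged.\<close>

lemma state_supermartingale:
  assumes \<sigma>: "\<sigma> \<in> {1, -1}"
  shows "let q = measure unit_uniform {..snd (s h)} in
    q * potential \<sigma> \<theta> Q (state (True # h)) + (1 - q) * potential \<sigma> \<theta> Q (state (False # h))
    \<le> potential \<sigma> \<theta> Q (state h)"
proof -
  obtain i p where ip: "s h = (i, p)" by fastforce
  show ?thesis
  proof (cases "legal_move n m a \<alpha> (wt h) (i, p) \<and> i \<in> set active")
    case True
    then have p: "0 < p" "p \<le> 1" by (auto simp: legal_move_iff)
    have "state (True # h) = (state h)(i := state h i / p)" "state (False # h) = (state h)(i := 0)"
      using True by (auto simp: state_def ip make_move_def fun_eq_iff Let_def)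
    then show ?thesis
      using potential_martingale[of i p \<sigma> \<theta> Q "state h"] True p
      by (simp add: ip measure_unit_uniform_atMost)
  next
    case False
    then have "state (b # h) = state h" for b
      by (auto simp: state_def ip make_move_def fun_eq_iff Let_def)
    then show ?thesis by (simp add: Let_def algebra_simps)
  qed
qed

text \<open>One side of the violated condition: the upper bound fails for
  \<open>\<sigma> = 1\<close>, the lower one for \<open>\<sigma> = -1\<close>.\<close>

definition deviates :: "real \<Rightarrow> bool list \<Rightarrow> bool" where
  "deviates \<sigma> h \<longleftrightarrow> (\<exists>v\<in>carrier_vec n.
     (\<sigma> + \<epsilon>) * (\<Sum>i<m. (a i \<bullet> v)\<^sup>2) < \<sigma> * (\<Sum>i<m. wt h i * (a i \<bullet> v)\<^sup>2))"

lemma violated_iff: "violated n m a \<epsilon> (wt h) \<longleftrightarrow> deviates 1 h \<or> deviates (- 1) h"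
proof -
  have "(1 + \<epsilon>) * x < 1 * y \<longleftrightarrow> (1 + \<epsilon>) * x < y" "(- 1 + \<epsilon>) * x < - 1 * y \<longleftrightarrow> y < (1 - \<epsilon>) * x" for x y
    by (auto simp: algebra_simps)
  then show ?thesis
    unfolding deviates_def by (auto simp: violated_gram_iff a)
qed

lemma deviates_potential_ge:
  assumes \<sigma>: "\<sigma> \<in> {1, -1}" and \<theta>: "0 \<le> \<theta>" and dev: "deviates \<sigma> h"
  shows "(\<Sum>q<Q. (\<theta> * (shift + \<sigma> + \<epsilon>)) ^ q / fact q) \<le> potential \<sigma> \<theta> Q (state h)"
proof -
  obtain x where x: "x \<in> carrier_vec n"
    and gt: "(\<sigma> + \<epsilon>) * (\<Sum>i<m. (a i \<bullet> x)\<^sup>2) < \<sigma> * (\<Sum>i<m. wt h i * (a i \<bullet> x)\<^sup>2)"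
    using dev by (auto simp: deviates_def)
  define v where "v = (\<lambda>i. a i \<bullet> x)"
  have v: "v \<in> fixed"
    unfolding fixed_def v_def using lev_fixes_coordinates[OF _ x] by simp
  have same: "wt h i * (v i)\<^sup>2 = state h i * (v i)\<^sup>2" if i: "i < m" for i
  proof -
    consider "i \<in> set active" | "1 / \<alpha> < lev i i" | "lev i i = 0"
      using i lev_nonneg[OF i] by (force simp: set_active)
    then show ?thesis
    proof cases
      case 1
      then show ?thesis by (simp add: state_def)
    next
      case 2
      then show ?thesis
        using weights_invariant[of h] i by (auto simp: state_def)
    next
      case 3
      then have "(\<Sum>j<m. (lev i j)\<^sup>2) = 0"
        using diag_eq_sum_squares[OF i] by simp
      then have "\<forall>j\<in>{..<m}. (lev i j)\<^sup>2 = 0"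
        by (subst (asm) sum_nonneg_eq_0_iff) auto
      then have "v i = 0"
        using sum_L_fixed[OF v i] by simp
      then show ?thesis by simp
    qed
  qed
  have W: "(\<Sum>i<m. wt h i * (a i \<bullet> x)\<^sup>2) = (\<Sum>i<m. state h i * (v i)\<^sup>2)"
    using same unfolding v_def by (intro sum.cong refl) simp
  have S: "(\<Sum>i<m. (a i \<bullet> x)\<^sup>2) = (\<Sum>l<m. v l * v l)"
    by (simp add: v_def power2_eq_square)
  \<comment> \<open>If all \<open>v l\<close> were zero, both sides of the strict inequality
    \<open>gt\<close> would vanish.\<close>
  have pos: "0 < (\<Sum>l<m. v l * v l)"
  proof (rule ccontr)
    assume "\<not> ?thesis"
    then have "(\<Sum>l<m. v l * v l) = 0"
      by (simp add: sum_nonneg order.antisym not_less)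
    moreover from this have "\<forall>l\<in>{..<m}. v l * v l = 0"
      by (subst (asm) sum_nonneg_eq_0_iff) auto
    ultimately show False using gt unfolding W S by simp
  qed
  show ?thesis
  proof (rule potential_ge[OF \<sigma> \<theta> state_feasible v pos])
    show "0 \<le> shift + \<sigma> + \<epsilon>" using shift_ge_1 \<sigma> eps by auto
    have "(\<Sum>l<m. (shift + \<sigma> * state h l) * v l * v l)
        = shift * (\<Sum>l<m. v l * v l) + \<sigma> * (\<Sum>i<m. state h i * (v i)\<^sup>2)"
      unfolding sum_distrib_left sum.distrib[symmetric]
      by (intro sum.cong refl) (simp add: power2_eq_square algebra_simps)
    then show "(shift + \<sigma> + \<epsilon>) * (\<Sum>l<m. v l * v l) \<le> (\<Sum>l<m. (shift + \<sigma> * state h l) * v l * v l)"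
      using gt unfolding W S by (simp add: algebra_simps)
  qed
qed

lemma deviation_probability:
  assumes \<sigma>: "\<sigma> \<in> {1, -1}"
  shows "measure coins {\<omega> \<in> space coins. \<exists>t\<le>T. deviates \<sigma> (extend_history s [] \<omega> t)}
    \<le> real n * exp (- (\<epsilon>\<^sup>2 * \<alpha> / 8))"
    (is "?P \<le> _")
proof -
  \<comment> \<open>With this choice \<open>\<theta> / \<alpha> = \<epsilon> / 2\<close>, which
    leaves room below \<open>\<epsilon>\<close> for the second-order term of the
    exponential.\<close>
  define \<theta> where "\<theta> = \<epsilon> * \<alpha> / 2"
  define b where "b = shift + \<sigma> + \<epsilon>"
  have \<theta>: "0 \<le> \<theta>" using alpha_pos eps by (simp add: \<theta>_def)
  have b: "0 < b" using shift_ge_1 \<sigma> eps by (auto simp: b_def)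
  have x: "\<theta> * (1 / \<alpha>) = \<epsilon> / 2" using alpha_pos by (simp add: \<theta>_def)
  define B where "B = real n * exp (\<theta> * (shift + \<sigma> * exp (\<sigma> * (\<epsilon> / 2))))"
  have "?P * (\<Sum>q<Suc Q. (\<theta> * b) ^ q / fact q) \<le> B" for Q
  proof -
    let ?S = "\<Sum>q<Suc Q. (\<theta> * b) ^ q / fact q"
    have S: "0 < ?S"
      using \<theta> b by (subst sum.lessThan_Suc_shift) (auto intro!: add_pos_nonneg sum_nonneg)
    have "?P \<le> potential \<sigma> \<theta> (Suc Q) (state []) / ?S"
      using potential_nonneg[OF \<sigma> \<theta> state_feasible] S deviates_potential_ge[OF \<sigma> \<theta>]
        state_supermartingale[OF \<sigma>]
      unfolding b_def by (rule ville_finite_horizon)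
    also have "\<dots> \<le> B / ?S"
    proof (rule divide_right_mono)
      have "state [] = (\<lambda>_. 1)" by (auto simp: state_def)
      then have "potential \<sigma> \<theta> (Suc Q) (state [])
          \<le> (\<Sum>i<m. lev i i) * exp (\<theta> * (shift + \<sigma> * exp (\<sigma> * (\<theta> * (1 / \<alpha>)))))"
        using potential_init_le[OF \<sigma> \<theta>] by simp
      also have "\<dots> \<le> B"
        unfolding B_def x using sum_lev_le by (intro mult_right_mono) auto
      finally show "potential \<sigma> \<theta> (Suc Q) (state []) \<le> B" .
    qed (use S in simp)
    finally show ?thesis using S by (simp add: pos_le_divide_eq del: sum.lessThan_Suc)
  qed
  then have "?P * exp (\<theta> * b) \<le> B" by (rule mult_exp_le_of_partial_sums)
  then have "?P \<le> B * exp (- (\<theta> * b))"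
    by (simp add: exp_minus field_simps)
  \<comment> \<open>The large \<open>shift\<close> occurs in both exponents and cancels.\<close>
  also have "\<dots> = real n * exp (\<theta> * (\<sigma> * (exp (\<sigma> * (\<epsilon> / 2)) - 1) - \<epsilon>))"
    unfolding B_def b_def by (simp add: mult.assoc exp_add[symmetric] algebra_simps)
  also have "\<dots> \<le> real n * exp (\<theta> * (- \<epsilon> / 4))"
  proof -
    \<comment> \<open>The first-order term is \<open>\<epsilon> / 2\<close> and the square is at
      most \<open>\<epsilon> / 4\<close>, so a margin of \<open>\<epsilon> / 4\<close> survives in
      the exponent.\<close>
    have "\<sigma> * (exp (\<sigma> * (\<epsilon> / 2)) - 1) \<le> \<epsilon> / 2 + (\<epsilon> / 2)\<^sup>2"
    proof (cases "\<sigma> = 1")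
      case True
      then show ?thesis using exp_bound[of "\<epsilon> / 2"] eps by simp
    next
      case False
      then have "\<sigma> * (exp (\<sigma> * (\<epsilon> / 2)) - 1) = 1 - exp (- (\<epsilon> / 2))" using \<sigma> by simp
      moreover have "1 - \<epsilon> / 2 \<le> exp (- (\<epsilon> / 2))"
        using exp_ge_add_one_self[of "- (\<epsilon> / 2)"] by simp
      ultimately show ?thesis using zero_le_power2[of "\<epsilon> / 2"] by linarith
    qed
    also have "\<dots> \<le> \<epsilon> - \<epsilon> / 4"
    proof -
      have "\<epsilon> * \<epsilon> \<le> \<epsilon> * 1" using eps by (intro mult_left_mono) auto
      then show ?thesis by (simp add: power2_eq_square)
    qed
    finally show ?thesis
      using \<theta> by (intro mult_left_mono iffD2[OF exp_le_cancel_iff]) auto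
  qed
  also have "\<theta> * (- \<epsilon> / 4) = - (\<epsilon>\<^sup>2 * \<alpha> / 8)"
    by (simp add: \<theta>_def power2_eq_square)
  finally show ?thesis .
qed

text \<open>The two signs cost a factor two, and continuity from below carries the bounds for finite
  horizons to the whole game.\<close>

lemma adversary_win_probability:
  "measure coins {\<omega> \<in> space coins. adversary_wins n m a \<alpha> \<epsilon> s \<omega>} \<le> 2 * real n * exp (- (\<epsilon>\<^sup>2 * \<alpha> / 8))"
    (is "measure coins ?A \<le> ?b")
proof -
  interpret coins: prob_space coins by (rule prob_space_coins)
  define E where "E = (\<lambda>\<sigma> T. {\<omega> \<in> space coins. \<exists>t\<le>T. deviates \<sigma> (extend_history s [] \<omega> t)})"
  have E: "E \<sigma> T \<in> sets coins" for \<sigma> T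
    unfolding E_def by measurable
  have bound: "coins.prob (E 1 T \<union> E (- 1) T) \<le> ?b" for T
  proof -
    have "coins.prob (E 1 T \<union> E (- 1) T) \<le> coins.prob (E 1 T) + coins.prob (E (- 1) T)"
      by (rule measure_Un_le[OF E E])
    also have "\<dots> \<le> ?b"
      using deviation_probability[of 1 T] deviation_probability[of "- 1" T] by (simp add: E_def)
    finally show ?thesis .
  qed
  have lim: "(\<lambda>T. coins.prob (E 1 T \<union> E (- 1) T)) \<longlonglongrightarrow> coins.prob (\<Union>T. E 1 T \<union> E (- 1) T)"
  proof (rule coins.finite_Lim_measure_incseq)
    show "incseq (\<lambda>T. E 1 T \<union> E (- 1) T)"
      unfolding E_def by (rule incseq_SucI) (auto intro: le_SucI)
  qed (use E in auto)
  have "coins.prob (\<Union>T. E 1 T \<union> E (- 1) T) \<le> ?b"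
    by (rule LIMSEQ_le_const2[OF lim]) (use bound in blast)
  moreover have "(\<Union>T. E 1 T \<union> E (- 1) T) = ?A"
    unfolding adversary_wins_iff violated_iff history_eq_extend E_def by blast
  ultimately show ?thesis by (simp only:)
qed

end

section \<open>Choice of the constant and averaging over the seed\<close>

theorem theorem5:
  fixes c :: real
  assumes "c > 0"
  shows "\<exists>C>0. \<forall>(n::nat) (m::nat) (a :: nat \<Rightarrow> real vec) (\<epsilon>::real) (\<alpha>::real) (R :: real measure) (\<sigma> :: real \<Rightarrow> strategy).
    n \<ge> 2 \<longrightarrow> 0 < \<epsilon> \<longrightarrow> \<epsilon> < 1/2 \<longrightarrow> (\<forall>i<m. a i \<in> carrier_vec n) \<longrightarrow>
    \<alpha> = C * (1 / \<epsilon>^2) * ln (real n) \<longrightarrow> adversary n m a \<alpha> R \<sigma> \<longrightarrow>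
      win_event n m a \<alpha> \<epsilon> R \<sigma> \<in> sets (R \<Otimes>\<^sub>M coins) \<and>
      measure (R \<Otimes>\<^sub>M coins) (win_event n m a \<alpha> \<epsilon> R \<sigma>) \<le> real n powr (- c)"
proof (intro exI[of _ "8 * (c + 2)"] conjI allI impI)
  \<comment> \<open>The factor 8 cancels the one in the exponent, leaving
    \<open>2 * n * n powr (- (c + 2))\<close>. Since \<open>2 \<le> n\<close>, the prefactor is at
    most \<open>n powr 2\<close>, which the summand 2 absorbs.\<close>
  show "0 < 8 * (c + 2)" using assms by simp
  fix n m :: nat and a :: "nat \<Rightarrow> real vec" and \<epsilon> \<alpha> :: real and R :: "real measure" and \<sigma> :: "real \<Rightarrow> strategy"
  assume n: "n \<ge> 2" and \<epsilon>: "0 < \<epsilon>" "\<epsilon> < 1 / 2" and a: "\<forall>i<m. a i \<in> carrier_vec n"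
    and \<alpha>: "\<alpha> = 8 * (c + 2) * (1 / \<epsilon>^2) * ln (real n)" and adv: "adversary n m a \<alpha> R \<sigma>"
  have \<sigma>: "(\<lambda>r. \<sigma> r h) \<in> R \<rightarrow>\<^sub>M (count_space UNIV \<Otimes>\<^sub>M borel)" for h
    using adv by (simp add: adversary_def)
  show meas: "win_event n m a \<alpha> \<epsilon> R \<sigma> \<in> sets (R \<Otimes>\<^sub>M coins)"
    by (rule win_event_measurable) (use a \<sigma> in auto)
  interpret R: prob_space R using adv by (simp add: adversary_def)
  interpret coins: prob_space coins by (rule prob_space_coins)
  interpret pair: pair_prob_space R coins ..
  have "0 < \<alpha>" using \<alpha> n \<epsilon> assms by simp
  have fiber: "measure coins {\<omega> \<in> space coins. adversary_wins n m a \<alpha> \<epsilon> (\<sigma> r) \<omega>} \<le> real n powr (- c)" for r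
  proof -
    interpret resparsification_game n m a \<alpha> \<epsilon> "\<sigma> r"
      by unfold_locales (use a \<open>0 < \<alpha>\<close> \<epsilon> in auto)
    have eq: "\<epsilon>\<^sup>2 * \<alpha> / 8 = (c + 2) * ln (real n)"
      using \<epsilon> by (simp add: \<alpha>)
    have "exp (- (\<epsilon>\<^sup>2 * \<alpha> / 8)) = real n powr (- (c + 2))"
      unfolding eq using n by (simp add: powr_def algebra_simps)
    then have "measure coins {\<omega> \<in> space coins. adversary_wins n m a \<alpha> \<epsilon> (\<sigma> r) \<omega>}
        \<le> 2 * real n * real n powr (- (c + 2))"
      using adversary_win_probability by simp
    also have "\<dots> \<le> (real n * real n) * real n powr (- (c + 2))"
      using n by (intro mult_right_mono) auto
    also have "\<dots> = real n powr 2 * real n powr (- (c + 2))"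
      using n by (simp add: powr_numeral power2_eq_square)
    also have "\<dots> = real n powr (- c)"
      unfolding powr_add[symmetric] by simp
    finally show ?thesis .
  qed
  \<comment> \<open>The seed is independent of the coins, so by Fubini the bound for each
    deterministic strategy integrates to the randomized one.\<close>
  have "emeasure (R \<Otimes>\<^sub>M coins) (win_event n m a \<alpha> \<epsilon> R \<sigma>)
      = (\<integral>\<^sup>+r. emeasure coins (Pair r -` win_event n m a \<alpha> \<epsilon> R \<sigma>) \<partial>R)"
    by (rule coins.emeasure_pair_measure_alt[OF meas])
  also have "\<dots> \<le> (\<integral>\<^sup>+r. ennreal (real n powr (- c)) \<partial>R)"
  proof (rule nn_integral_mono)
    fix r assume "r \<in> space R"
    then have "Pair r -` win_event n m a \<alpha> \<epsilon> R \<sigma> = {\<omega> \<in> space coins. adversary_wins n m a \<alpha> \<epsilon> (\<sigma> r) \<omega>}"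
      by (auto simp: win_event_def space_pair_measure)
    then show "emeasure coins (Pair r -` win_event n m a \<alpha> \<epsilon> R \<sigma>) \<le> ennreal (real n powr (- c))"
      using fiber[of r] by (simp add: coins.emeasure_eq_measure ennreal_leI)
  qed
  also have "\<dots> = ennreal (real n powr (- c))"
    by (simp add: R.emeasure_space_1)
  finally show "measure (R \<Otimes>\<^sub>M coins) (win_event n m a \<alpha> \<epsilon> R \<sigma>) \<le> real n powr (- c)"
    by (simp add: pair.P.emeasure_eq_measure)
qed

end
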